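(* Let $0<\alpha<1$, let $\xi_\alpha$ be fractional Brownian motion with exponent $\alpha$ on a probability space $(\Omega,\mathcal{F},P)$, and let $f(t,\omega)=f(t)$ be a real function of $t$ only (i.e. deterministic). If $f\in L^{\frac{2}{1+\alpha}}([0,\infty))$, then the stochastic integral $\int_0^t f(\tau)\,d\xi_\alpha(\tau,\omega)$ exists in $L^2([0,\infty)\times\Omega)$ for all $t\in[0,\infty)$.
   Context: Fractional Brownian motion $\xi_\alpha(t,\omega)$, $t\ge0$, with exponent $\alpha$ is the centered Gaussian process with stationary increments and covariance $E(\xi_\alpha(s)\xi_\alpha(t))=C(s^{1+\alpha}+t^{1+\alpha}-|s-t|^{1+\alpha})$, where $C=-\frac{\Gamma(1-\alpha)}{\alpha}\,\frac{\cos(\frac{1+\alpha}{2}\pi)}{\frac{1+\alpha}{2}\pi}$. For fixed $t>0$ put $s_i^n=\frac{i}{2^n}t$. For a simple function $\phi=\sum_{i=0}^{2^n-1}\phi(s_i^n)\chi_{[s_i^n,s_{i+1}^n]}$ ($\chi$ denoting indicator functions) the integral is defined as $\int_0^t\phi(\tau)\,d\xi_\alpha(\tau)=\sum_{i=0}^{2^n-1}\phi(s_i^n)\,(\xi_\alpha(s_{i+1}^n)-\xi_\alpha(s_i^n))$. For general deterministic $f$ the integral is constructed as the $L^2$-limit of $\int_0^t\phi_n(\tau)\,d\xi_\alpha(\tau)$ for simple functions $\phi_n$ converging to $f$ in $L^{\frac{2}{1+\alpha}}$.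
   Formalization: Membership in L^2([0,∞)×Ω) is replaced by L^2(Ω) for each t and L^2([0,T]×Ω) for every finite T, since for f the indicator of [0,1] the integral is ξ(1)−ξ(0) for all t≥1 and is not square integrable over [0,∞)×Ω. *)

theory Defs
  imports "HOL-Probability.Probability"
begin

definition in_Lp :: "real \<Rightarrow> 'a measure \<Rightarrow> ('a \<Rightarrow> real) \<Rightarrow> bool" where
  "in_Lp p M f \<longleftrightarrow> f \<in> borel_measurable M \<and> integrable M (\<lambda>x. \<bar>f x\<bar> powr p)"

definition Lp_norm :: "real \<Rightarrow> 'a measure \<Rightarrow> ('a \<Rightarrow> real) \<Rightarrow> real" where
  "Lp_norm p M f = (LINT x|M. \<bar>f x\<bar> powr p) powr (1 / p)"

definition tendsto_in_Lp :: "real \<Rightarrow> 'a measure \<Rightarrow> (nat \<Rightarrow> 'a \<Rightarrow> real) \<Rightarrow> ('a \<Rightarrow> real) \<Rightarrow> bool" where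
  "tendsto_in_Lp p M F f \<longleftrightarrow>
     (\<forall>n. in_Lp p M (F n)) \<and> in_Lp p M f \<and>
     (\<lambda>n. Lp_norm p M (\<lambda>x. F n x - f x)) \<longlonglongrightarrow> 0"

(* Constants count as (degenerate) Gaussian random variables; this is needed because a
   fractional Brownian motion vanishes almost surely at time 0. *)
definition gaussian_rv :: "'a measure \<Rightarrow> ('a \<Rightarrow> real) \<Rightarrow> bool" where
  "gaussian_rv M X \<longleftrightarrow> X \<in> borel_measurable M \<and>
     (\<exists>\<mu> \<sigma>. (\<sigma> > 0 \<and> distributed M lborel X (normal_density \<mu> \<sigma>)) \<or> (AE \<omega> in M. X \<omega> = \<mu>))"

(* Processes are indexed by real numbers, but only times t \<ge> 0 are ever considered. *)
definition centered_gaussian_process :: "'a measure \<Rightarrow> (real \<Rightarrow> 'a \<Rightarrow> real) \<Rightarrow> bool" where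
  "centered_gaussian_process M X \<longleftrightarrow>
     (\<forall>t\<ge>0. X t \<in> borel_measurable M) \<and>
     (\<forall>J c. finite J \<and> J \<subseteq> {0..} \<longrightarrow> gaussian_rv M (\<lambda>\<omega>. \<Sum>t\<in>J. c t * X t \<omega>)) \<and>
     (\<forall>t\<ge>0. prob_space.expectation M (X t) = 0)"

definition stationary_increments :: "'a measure \<Rightarrow> (real \<Rightarrow> 'a \<Rightarrow> real) \<Rightarrow> bool" where
  "stationary_increments M X \<longleftrightarrow>
     (\<forall>J h. finite J \<and> J \<subseteq> {0..} \<and> h \<ge> 0 \<longrightarrow>
        distr M (Pi\<^sub>M J (\<lambda>_. borel)) (\<lambda>\<omega>. \<lambda>t\<in>J. X (t + h) \<omega> - X h \<omega>) =
        distr M (Pi\<^sub>M J (\<lambda>_. borel)) (\<lambda>\<omega>. \<lambda>t\<in>J. X t \<omega> - X 0 \<omega>))"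

definition fbm_const :: "real \<Rightarrow> real" where
  "fbm_const \<alpha> = - (Gamma (1 - \<alpha>) / \<alpha>) * (cos ((1 + \<alpha>) / 2 * pi) / ((1 + \<alpha>) / 2 * pi))"

definition fractional_brownian_motion :: "'a measure \<Rightarrow> real \<Rightarrow> (real \<Rightarrow> 'a \<Rightarrow> real) \<Rightarrow> bool" where
  "fractional_brownian_motion M \<alpha> \<xi> \<longleftrightarrow>
     centered_gaussian_process M \<xi> \<and> stationary_increments M \<xi> \<and>
     (\<forall>s\<ge>0. \<forall>t\<ge>0. prob_space.expectation M (\<lambda>\<omega>. \<xi> s \<omega> * \<xi> t \<omega>) =
        fbm_const \<alpha> * (s powr (1 + \<alpha>) + t powr (1 + \<alpha>) - \<bar>s - t\<bar> powr (1 + \<alpha>)))"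

definition dyadic_point :: "real \<Rightarrow> nat \<Rightarrow> nat \<Rightarrow> real" where
  "dyadic_point t n i = real i / 2 ^ n * t"

(* The cells are half-open, so that the coefficient of the i-th cell really is the value of
   the function at its left endpoint; with closed cells adjacent terms would add up at the
   common endpoint.  The value at the single point t is irrelevant. *)
definition dyadic_simple :: "real \<Rightarrow> nat \<Rightarrow> (real \<Rightarrow> real) \<Rightarrow> bool" where
  "dyadic_simple t n \<phi> \<longleftrightarrow>
     (\<forall>\<tau>\<in>{0..<t}. \<phi> \<tau> = (\<Sum>i<2 ^ n. \<phi> (dyadic_point t n i) *
        indicator {dyadic_point t n i..<dyadic_point t n (Suc i)} \<tau>))"

definition simple_stochastic_integral ::
    "(real \<Rightarrow> 'a \<Rightarrow> real) \<Rightarrow> real \<Rightarrow> nat \<Rightarrow> (real \<Rightarrow> real) \<Rightarrow> 'a \<Rightarrow> real" where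
  "simple_stochastic_integral \<xi> t n \<phi> \<omega> =
     (\<Sum>i<2 ^ n. \<phi> (dyadic_point t n i) *
        (\<xi> (dyadic_point t n (Suc i)) \<omega> - \<xi> (dyadic_point t n i) \<omega>))"

(* The dyadic level m n is an arbitrary function of n. *)
definition simple_approximation ::
    "real \<Rightarrow> (real \<Rightarrow> real) \<Rightarrow> real \<Rightarrow> (nat \<Rightarrow> nat) \<Rightarrow> (nat \<Rightarrow> real \<Rightarrow> real) \<Rightarrow> bool" where
  "simple_approximation \<alpha> f t m \<phi> \<longleftrightarrow>
     (\<forall>n. dyadic_simple t (m n) (\<phi> n)) \<and>
     tendsto_in_Lp (2 / (1 + \<alpha>)) (lebesgue_on {0..t}) \<phi> f"

(* Existence of the L^2-limit includes independence of the approximating sequence; the first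
   conjunct excludes vacuity.  The integral is determined only up to a null set. *)
definition has_stochastic_integral ::
    "'a measure \<Rightarrow> real \<Rightarrow> (real \<Rightarrow> 'a \<Rightarrow> real) \<Rightarrow> (real \<Rightarrow> real) \<Rightarrow> real \<Rightarrow> ('a \<Rightarrow> real) \<Rightarrow> bool" where
  "has_stochastic_integral M \<alpha> \<xi> f t Y \<longleftrightarrow>
     (\<exists>m \<phi>. simple_approximation \<alpha> f t m \<phi>) \<and>
     (\<forall>m \<phi>. simple_approximation \<alpha> f t m \<phi> \<longrightarrow>
        tendsto_in_Lp 2 M (\<lambda>n. simple_stochastic_integral \<xi> t (m n) (\<phi> n)) Y)"

end

theory Submission
  imports Defs
begin

text \<open>
  Everything rests on one estimate: for a step function \<open>g = (\<Sum>i. c i * indicator [a i, b i))\<close>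
  and \<open>X = (\<Sum>i. c i * (\<xi> (b i) - \<xi> (a i)))\<close> the second moment of \<open>X\<close> is at most a constant times
  the square of the \<open>L\<^sup>p\<close> norm of \<open>g\<close>, where \<open>p = 2 / (1 + \<alpha>)\<close>
  (\<open>fbm.elementary_integral_bound\<close>). Given this, the map from \<open>g\<close> to \<open>X\<close> extends by density
  and completeness of \<open>L\<^sup>2\<close>, and its value does not depend on the approximating sequence.

  The covariance of increments over cells at distance \<open>k\<close> of an equidistant grid is a second
  difference of \<open>k powr (1 + \<alpha>)\<close>, hence of order \<open>k powr (\<alpha> - 1)\<close>
  (\<open>second_difference_powr_le\<close>). On such a grid the estimate is therefore the diagonal
  Hardy--Littlewood--Sobolev inequality for sequences (\<open>discrete_HLS\<close>), whose exponent is
  exactly \<open>p\<close>. Its proof is elementary: by symmetry only pairs with \<open>c j \<le> c i\<close> matter, and a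
  row is bounded by cutting it at a distance that depends on \<open>c i\<close> (\<open>HLS_row\<close>). Because the
  estimate scales correctly in the mesh, it passes to arbitrary endpoints by rounding them to
  finer and finer grids.

  Step functions with arbitrary, even overlapping intervals are essential, since integrals up to
  different times \<open>t\<close> live on different dyadic grids. They allow the integral of a function to be
  characterised by its distance to all elementary integrals (\<open>fbm.wiener_integral\<close>), and they
  show that \<open>t \<mapsto> \<integral>\<^sub>0\<^sup>t f d\<xi>\<close> is uniformly continuous in mean square. The process \<open>\<xi>\<close> is not known
  to be jointly measurable, and neither are the integrals when chosen separately for each
  \<open>t\<close>; continuity provides a jointly measurable modification (\<open>measurable_modification\<close>), whose
  second moments are bounded uniformly in \<open>t\<close>, so that it is square integrable on every
  \<open>[0, T] \<times> \<Omega>\<close>.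
\<close>

section \<open>A discrete Hardy--Littlewood--Sobolev inequality\<close>

text \<open>Telescoping against \<open>m powr \<alpha>\<close>, whose increments dominate
  \<open>\<alpha> m powr (\<alpha> - 1)\<close> by concavity.\<close>

lemma sum_powr_le:
  fixes \<alpha> :: real and n :: nat
  assumes "0 < \<alpha>" "\<alpha> < 1"
  shows "(\<Sum>m=1..n. real m powr (\<alpha> - 1)) \<le> real n powr \<alpha> / \<alpha>"
proof (induction n)
  case 0
  then show ?case by simp
next
  case (Suc n)
  have step: "\<alpha> * real (Suc n) powr (\<alpha> - 1) \<le> real (Suc n) powr \<alpha> - real n powr \<alpha>"
  proof (cases "n = 0")
    case True
    then show ?thesis using assms by simp
  next
    case False
    have "\<exists>z>real n. z < real (Suc n) \<and>
        real (Suc n) powr \<alpha> - real n powr \<alpha> = (real (Suc n) - real n) * (\<alpha> * z powr (\<alpha> - 1))"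
      using False by (intro MVT2) (auto intro!: derivative_eq_intros simp: field_simps powr_diff)
    then obtain z where z: "real n < z" "z < real (Suc n)"
      "real (Suc n) powr \<alpha> - real n powr \<alpha> = \<alpha> * z powr (\<alpha> - 1)"
      by auto
    have "real (Suc n) powr (\<alpha> - 1) \<le> z powr (\<alpha> - 1)"
      using z(1,2) assms False by (intro powr_mono2') auto
    then show ?thesis using z(3) assms by simp
  qed
  then have "real (Suc n) powr (\<alpha> - 1) \<le> (real (Suc n) powr \<alpha> - real n powr \<alpha>) / \<alpha>"
    using assms by (simp add: field_simps)
  with Suc show ?case by (simp add: diff_divide_distrib)
qed

lemma sum_inverse_square_tail_le:
  fixes n N :: nat
  assumes "1 \<le> n"
  shows "(\<Sum>m\<in>{n<..N}. 1 / (real m)\<^sup>2) \<le> 1 / real n"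
proof -
  have "(\<Sum>m\<in>{n<..n+k}. 1 / (real m)\<^sup>2) \<le> 1 / real n - 1 / real (n + k)" for k
  proof (induction k)
    case 0
    then show ?case by simp
  next
    case (Suc k)
    have "{n<..n + Suc k} = insert (n + Suc k) {n<..n + k}" by auto
    moreover have "1 / (real (n + Suc k))\<^sup>2 \<le> 1 / real (n + k) - 1 / real (n + Suc k)"
      using assms by (simp add: divide_simps power2_eq_square)
    ultimately show ?case using Suc by simp
  qed
  note tele = this
  show ?thesis
  proof (cases "n \<le> N")
    case True
    then have "(\<Sum>m\<in>{n<..N}. 1 / (real m)\<^sup>2) \<le> 1 / real n - 1 / real N"
      using tele[of "N - n"] by simp
    also have "\<dots> \<le> 1 / real n" by simp
    finally show ?thesis .
  next
    case False
    then show ?thesis by simp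
  qed
qed

text \<open>On each side of \<open>i\<close> the distance to \<open>i\<close> is injective; hence the factor 2.\<close>

lemma sum_distance_le:
  fixes h :: "nat \<Rightarrow> real" and i :: nat
  assumes "finite S" "finite T" and h: "\<And>m. m \<in> T \<Longrightarrow> 0 \<le> h m"
    and ST: "\<And>j. j \<in> S \<Longrightarrow> 1 + nat \<bar>int i - int j\<bar> \<in> T"
  shows "(\<Sum>j\<in>S. h (1 + nat \<bar>int i - int j\<bar>)) \<le> 2 * sum h T"
proof -
  let ?d = "\<lambda>j. 1 + nat \<bar>int i - int j\<bar>"
  have side: "(\<Sum>j\<in>S'. h (?d j)) \<le> sum h T" if "S' \<subseteq> S" "inj_on ?d S'" for S'
  proof -
    have "(\<Sum>j\<in>S'. h (?d j)) = sum h (?d ` S')"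
      using that by (simp add: sum.reindex)
    also have "\<dots> \<le> sum h T"
      using that ST h assms by (intro sum_mono2) auto
    finally show ?thesis .
  qed
  have "(\<Sum>j\<in>S. h (?d j)) = (\<Sum>j\<in>S \<inter> {..i}. h (?d j)) + (\<Sum>j\<in>S \<inter> {i<..}. h (?d j))"
    using assms(1) by (subst sum.union_disjoint [symmetric]) (auto intro: sum.cong)
  also have "\<dots> \<le> sum h T + sum h T"
    by (intro add_mono side) (auto simp: inj_on_def)
  finally show ?thesis by simp
qed

text \<open>Write \<open>l = c i\<close>. The row is cut at distance \<open>n \<approx> l powr -p\<close> from the diagonal: near the
  diagonal the bound \<open>c j \<le> l\<close> is used, far from it Young's inequality with the exponent
  \<open>p = 2 / (1 + \<alpha>)\<close>, whose conjugate \<open>2 / (1 - \<alpha>)\<close> turns the kernel into the summable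
  \<open>m powr -2\<close>. The cut balances both parts to \<open>l powr (p - 1)\<close>.\<close>

lemma HLS_row:
  fixes c :: "nat \<Rightarrow> real" and \<alpha> :: real
  defines "p \<equiv> 2 / (1 + \<alpha>)"
  assumes \<alpha>: "0 < \<alpha>" "\<alpha> < 1"
    and c: "\<And>j. 0 \<le> c j" and norm: "(\<Sum>j<N. c j powr p) \<le> 1"
    and i: "i < N" "0 < c i"
  shows "(\<Sum>j | j < N \<and> c j \<le> c i. c j * real (1 + nat \<bar>int i - int j\<bar>) powr (\<alpha> - 1))
           \<le> (8 / \<alpha> + 3) * c i powr (p - 1)"
proof -
  define l where "l = c i"
  define d where "d j = 1 + nat \<bar>int i - int j\<bar>" for j
  define R where "R = l powr (- p)"
  define n where "n = nat \<lceil>R\<rceil>"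
  have p: "1 < p" "0 < p" using \<alpha> by (auto simp: p_def field_simps)
  have l0: "0 < l" using i by (simp add: l_def)
  have "l powr p \<le> (\<Sum>j<N. c j powr p)"
    unfolding l_def using i by (intro member_le_sum) auto
  then have lp: "l powr p \<le> 1" using norm by simp
  have R1: "1 \<le> R" using lp l0 by (simp add: R_def powr_minus one_le_inverse_iff)
  have n: "R \<le> real n" "real n \<le> 2 * R" "1 \<le> n" using R1 by (auto simp: n_def) linarith+
  have d1: "1 \<le> d j" for j by (simp add: d_def)
  define S where "S = {j. j < N \<and> c j \<le> l}"
  have finS: "finite S" by (simp add: S_def)
  have near: "(\<Sum>j\<in>{j\<in>S. d j \<le> n}. c j * real (d j) powr (\<alpha> - 1)) \<le> 8 / \<alpha> * l powr (p - 1)"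
  proof -
    have "(\<Sum>j\<in>{j\<in>S. d j \<le> n}. c j * real (d j) powr (\<alpha> - 1))
        \<le> l * (\<Sum>j\<in>{j\<in>S. d j \<le> n}. real (d j) powr (\<alpha> - 1))"
      unfolding sum_distrib_left by (intro sum_mono mult_right_mono) (auto simp: S_def)
    also have "(\<Sum>j\<in>{j\<in>S. d j \<le> n}. real (d j) powr (\<alpha> - 1))
        \<le> 2 * (\<Sum>m=1..n. real m powr (\<alpha> - 1))"
      unfolding d_def using finS by (intro sum_distance_le) auto
    also have "\<dots> \<le> 2 * (real n powr \<alpha> / \<alpha>)"
      using sum_powr_le[OF \<alpha>, of n] by simp
    also have "real n powr \<alpha> \<le> (2 * R) powr \<alpha>"
      using n \<alpha> by (intro powr_mono2) auto
    also have "(2 * R) powr \<alpha> = 2 powr \<alpha> * R powr \<alpha>"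
      using R1 by (simp add: powr_mult)
    also have "2 powr \<alpha> \<le> (4::real)"
      using \<alpha> powr_mono[of \<alpha> 2 "2::real"] by simp
    finally have "(\<Sum>j\<in>{j\<in>S. d j \<le> n}. c j * real (d j) powr (\<alpha> - 1))
        \<le> l * (2 * (4 * R powr \<alpha> / \<alpha>))"
      using l0 \<alpha> by (simp add: divide_right_mono mult_left_mono mult_right_mono)
    also have "\<dots> = 8 / \<alpha> * (l powr 1 * R powr \<alpha>)" using l0 by simp
    also have "l powr 1 * R powr \<alpha> = l powr (p - 1)"
    proof -
      have "1 + - p * \<alpha> = p - 1" using \<alpha> by (simp add: p_def field_simps)
      then show ?thesis unfolding R_def powr_powr powr_add[symmetric] by (rule arg_cong)
    qed
    finally show ?thesis .
  qed
  have far: "(\<Sum>j\<in>{j\<in>S. n < d j}. c j * real (d j) powr (\<alpha> - 1)) \<le> 3 * l powr (p - 1)"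
  proof -
    define q where "q = 2 / (1 - \<alpha>)"
    have q: "1 < q" "1 / p + 1 / q = 1" using \<alpha> by (auto simp: p_def q_def field_simps)
    have young: "c j * real (d j) powr (\<alpha> - 1)
        \<le> l powr (p - 1) * (c j powr p + R * (1 / (real (d j))\<^sup>2))" for j
    proof -
      define b where "b = R powr (1 / q) * real (d j) powr (\<alpha> - 1)"
      have bq: "b powr q = R * (1 / (real (d j))\<^sup>2)"
      proof -
        have "(\<alpha> - 1) * q = - 2" using \<alpha> by (simp add: q_def field_simps)
        then have "(real (d j) powr (\<alpha> - 1)) powr q = 1 / (real (d j))\<^sup>2"
          using d1[of j] by (simp add: powr_powr powr_minus powr_realpow divide_inverse)
        then show ?thesis using R1 q by (simp add: b_def powr_mult powr_powr)
      qed
      have "c j * b \<le> c j powr p / p + b powr q / q"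
        using p q c by (intro Youngs_inequality) (auto simp: b_def)
      also have "\<dots> \<le> c j powr p + b powr q"
        using p q by (intro add_mono) (auto simp: divide_le_eq mult_le_cancel_left1)
      finally have *: "c j * b \<le> c j powr p + R * (1 / (real (d j))\<^sup>2)" by (simp add: bq)
      have "- (p * (1 / q)) = - (p - 1)"
        using q p \<alpha> by (simp add: p_def q_def field_simps)
      then have "R powr (1 / q) = l powr (- (p - 1))"
        by (simp add: R_def powr_powr)
      then have "l powr (p - 1) * R powr (1 / q) = 1"
        using l0 by (simp add: powr_add[symmetric])
      then have "c j * real (d j) powr (\<alpha> - 1) = l powr (p - 1) * (c j * b)"
        by (simp add: b_def mult.left_commute[of _ "c j"] mult.assoc[symmetric])
      also have "\<dots> \<le> l powr (p - 1) * (c j powr p + R * (1 / (real (d j))\<^sup>2))"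
        by (intro mult_left_mono *) auto
      finally show ?thesis .
    qed
    have "(\<Sum>j\<in>{j\<in>S. n < d j}. c j * real (d j) powr (\<alpha> - 1))
        \<le> (\<Sum>j\<in>{j\<in>S. n < d j}. l powr (p - 1) * (c j powr p + R * (1 / (real (d j))\<^sup>2)))"
      by (intro sum_mono young)
    also have "\<dots> = l powr (p - 1) * ((\<Sum>j\<in>{j\<in>S. n < d j}. c j powr p)
        + R * (\<Sum>j\<in>{j\<in>S. n < d j}. 1 / (real (d j))\<^sup>2))"
      by (simp only: sum_distrib_left[symmetric] sum.distrib)
    also have "\<dots> \<le> l powr (p - 1) * (1 + R * (2 * (1 / R)))"
    proof (intro mult_left_mono add_mono)
      have "(\<Sum>j\<in>{j\<in>S. n < d j}. c j powr p) \<le> (\<Sum>j<N. c j powr p)"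
        by (intro sum_mono2) (auto simp: S_def)
      then show "(\<Sum>j\<in>{j\<in>S. n < d j}. c j powr p) \<le> 1" using norm by simp
      have "(\<Sum>j\<in>{j\<in>S. n < d j}. 1 / (real (d j))\<^sup>2)
          \<le> 2 * (\<Sum>m\<in>{n<..1 + i + N}. 1 / (real m)\<^sup>2)"
        unfolding d_def using finS by (intro sum_distance_le) (auto simp: S_def)
      also have "\<dots> \<le> 2 * (1 / real n)"
        by (intro mult_left_mono sum_inverse_square_tail_le n) auto
      also have "\<dots> \<le> 2 * (1 / R)"
        using n R1 by (simp add: frac_le)
      finally show "(\<Sum>j\<in>{j\<in>S. n < d j}. 1 / (real (d j))\<^sup>2) \<le> 2 * (1 / R)" .
    qed (use R1 in auto)
    also have "\<dots> = 3 * l powr (p - 1)" using R1 by simp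
    finally show ?thesis .
  qed
  have "(\<Sum>j\<in>S. c j * real (d j) powr (\<alpha> - 1)) =
      (\<Sum>j\<in>{j\<in>S. d j \<le> n}. c j * real (d j) powr (\<alpha> - 1)) +
      (\<Sum>j\<in>{j\<in>S. n < d j}. c j * real (d j) powr (\<alpha> - 1))"
    using finS by (subst sum.union_disjoint [symmetric]) (auto intro: sum.cong)
  then show ?thesis
    using near far by (simp add: S_def d_def l_def algebra_simps)
qed

text \<open>In the double sum only pairs with \<open>c j \<le> c i\<close> need be considered, by symmetry; the row
  bound \<open>c i powr (p - 1)\<close> then sums to \<open>\<Sum>i. c i powr p\<close>. The general case follows by
  homogeneity, both sides being quadratic in \<open>c\<close> because \<open>p (1 + \<alpha>) = 2\<close>.\<close>

lemma discrete_HLS_normalised: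
  fixes c :: "nat \<Rightarrow> real" and \<alpha> :: real
  defines "p \<equiv> 2 / (1 + \<alpha>)"
  assumes \<alpha>: "0 < \<alpha>" "\<alpha> < 1"
    and c: "\<And>j. 0 \<le> c j" and norm: "(\<Sum>j<N. c j powr p) \<le> 1"
  shows "(\<Sum>i<N. \<Sum>j<N. c i * c j * real (1 + nat \<bar>int i - int j\<bar>) powr (\<alpha> - 1))
           \<le> 2 * (8 / \<alpha> + 3)"
proof -
  define w where "w i j = real (1 + nat \<bar>int i - int j\<bar>) powr (\<alpha> - 1)" for i j :: nat
  have w_sym: "w i j = w j i" for i j by (simp add: w_def abs_minus_commute)
  have w0: "0 \<le> w i j" for i j by (simp add: w_def)
  define h where "h i j = (if c j \<le> c i then c i * c j * w i j else 0)" for i j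
  have h_le: "c i * c j * w i j \<le> h i j + h j i" for i j
    using c w0 by (auto simp: h_def w_sym[of j i] algebra_simps)
  have row: "(\<Sum>j<N. h i j) \<le> (8 / \<alpha> + 3) * c i powr p" if "i < N" for i
  proof (cases "c i = 0")
    case True
    then show ?thesis by (simp add: h_def cong: if_cong)
  next
    case False
    then have ci: "0 < c i" using c[of i] by simp
    have "(\<Sum>j<N. h i j) = c i * (\<Sum>j | j < N \<and> c j \<le> c i. c j * w i j)"
      unfolding h_def sum_distrib_left
      by (intro sum.mono_neutral_cong_right) (auto simp: mult_ac)
    also have "\<dots> \<le> c i * ((8 / \<alpha> + 3) * c i powr (p - 1))"
      unfolding w_def p_def using \<alpha> c that ci norm[unfolded p_def]
      by (intro mult_left_mono HLS_row) auto
    also have "\<dots> = (8 / \<alpha> + 3) * c i powr p"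
      using ci by (simp add: powr_diff)
    finally show ?thesis .
  qed
  have hsum: "(\<Sum>i<N. \<Sum>j<N. h i j) \<le> 8 / \<alpha> + 3"
  proof -
    have "(\<Sum>i<N. \<Sum>j<N. h i j) \<le> (\<Sum>i<N. (8 / \<alpha> + 3) * c i powr p)"
      by (intro sum_mono row) auto
    also have "\<dots> = (8 / \<alpha> + 3) * (\<Sum>i<N. c i powr p)" by (simp add: sum_distrib_left)
    also have "\<dots> \<le> (8 / \<alpha> + 3) * 1" using norm \<alpha> by (intro mult_left_mono) auto
    finally show ?thesis by simp
  qed
  have "(\<Sum>i<N. \<Sum>j<N. c i * c j * w i j) \<le> (\<Sum>i<N. \<Sum>j<N. h i j + h j i)"
    by (intro sum_mono h_le)
  also have "\<dots> = (\<Sum>i<N. \<Sum>j<N. h i j) + (\<Sum>i<N. \<Sum>j<N. h j i)" by (simp add: sum.distrib)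
  also have "(\<Sum>i<N. \<Sum>j<N. h j i) = (\<Sum>i<N. \<Sum>j<N. h i j)" by (rule sum.swap)
  finally show ?thesis using hsum by (simp add: w_def)
qed

lemma discrete_HLS:
  fixes c :: "nat \<Rightarrow> real" and \<alpha> :: real
  assumes \<alpha>: "0 < \<alpha>" "\<alpha> < 1"
  shows "(\<Sum>i<N. \<Sum>j<N. \<bar>c i\<bar> * \<bar>c j\<bar> * real (1 + nat \<bar>int i - int j\<bar>) powr (\<alpha> - 1))
           \<le> 2 * (8 / \<alpha> + 3) * (\<Sum>j<N. \<bar>c j\<bar> powr (2 / (1 + \<alpha>))) powr (1 + \<alpha>)"
proof -
  define p where "p = 2 / (1 + \<alpha>)"
  define s where "s = (\<Sum>j<N. \<bar>c j\<bar> powr p)"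
  have p: "0 < p" "p * (1 + \<alpha>) = 2" using \<alpha> by (auto simp: p_def field_simps)
  have s0: "0 \<le> s" by (auto simp: s_def intro: sum_nonneg)
  show ?thesis
  proof (cases "s = 0")
    case True
    then have "\<forall>j<N. c j = 0" by (auto simp: s_def sum_nonneg_eq_0_iff)
    then show ?thesis using \<alpha> by simp
  next
    case False
    define r where "r = s powr (1 / p)"
    have r: "0 < r" "r powr p = s" using False s0 p by (auto simp: r_def powr_powr)
    have rr: "r * r = s powr (1 + \<alpha>)"
    proof -
      have "1 / p + 1 / p = 1 + \<alpha>" using p by (simp add: field_simps)
      then show ?thesis by (simp add: r_def powr_add[symmetric])
    qed
    have "(\<Sum>j<N. (\<bar>c j\<bar> / r) powr p) = 1"
      using r False by (simp add: powr_divide s_def sum_divide_distrib[symmetric])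
    then have "(\<Sum>i<N. \<Sum>j<N. (\<bar>c i\<bar> / r) * (\<bar>c j\<bar> / r) * real (1 + nat \<bar>int i - int j\<bar>) powr (\<alpha> - 1))
           \<le> 2 * (8 / \<alpha> + 3)"
      using r \<alpha> by (intro discrete_HLS_normalised) (auto simp: p_def)
    also have "(\<Sum>i<N. \<Sum>j<N. (\<bar>c i\<bar> / r) * (\<bar>c j\<bar> / r) * real (1 + nat \<bar>int i - int j\<bar>) powr (\<alpha> - 1))
        = (\<Sum>i<N. \<Sum>j<N. \<bar>c i\<bar> * \<bar>c j\<bar> * real (1 + nat \<bar>int i - int j\<bar>) powr (\<alpha> - 1)) / (r * r)"
      by (simp add: sum_divide_distrib)
    finally show ?thesis
      using False s0 unfolding rr by (simp add: pos_divide_le_eq s_def p_def)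
  qed
qed

section \<open>Second moments of increments\<close>

text \<open>The second difference of \<open>k powr (1 + \<alpha>)\<close> is comparable to the kernel of the discrete
  inequality: away from the diagonal the mean value theorem is applied twice.\<close>

lemma second_difference_powr_le:
  fixes \<alpha> :: real and k :: nat
  assumes \<alpha>: "0 < \<alpha>" "\<alpha> < 1"
  shows "\<bar>\<bar>real k + 1\<bar> powr (1 + \<alpha>) + \<bar>real k - 1\<bar> powr (1 + \<alpha>) - 2 * real k powr (1 + \<alpha>)\<bar>
           \<le> 12 * real (1 + k) powr (\<alpha> - 1)"
proof -
  consider "k = 0" | "k = 1" | "2 \<le> k" by linarith
  then show ?thesis
  proof cases
    case 1
    then show ?thesis by simp
  next
    case 2
    have "2 powr (1 + \<alpha>) \<le> (2::real) powr 2" "(2::real) powr (- 1) \<le> 2 powr (\<alpha> - 1)"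
      "(2::real) powr 1 \<le> 2 powr (1 + \<alpha>)"
      using \<alpha> by (intro powr_mono; simp)+
    then show ?thesis using 2 by (simp add: powr_minus)
  next
    case 3
    define x where "x = real k"
    have x: "2 \<le> x" using 3 by (simp add: x_def)
    have mvt1: "\<exists>z>a. z < b \<and> b powr (1 + \<alpha>) - a powr (1 + \<alpha>) = (b - a) * ((1 + \<alpha>) * z powr \<alpha>)"
      if "0 < a" "a < b" for a b :: real
    proof (rule MVT2)
      fix y assume "a \<le> y"
      then show "DERIV (\<lambda>z. z powr (1 + \<alpha>)) y :> (1 + \<alpha>) * y powr \<alpha>"
        using has_real_derivative_powr[of y "1 + \<alpha>"] that by simp
    qed (use that in auto)
    from mvt1[of x "x + 1"] x obtain u where
      u: "x < u" "u < x + 1" "(x + 1) powr (1 + \<alpha>) - x powr (1 + \<alpha>) = (1 + \<alpha>) * u powr \<alpha>" by auto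
    from mvt1[of "x - 1" x] x obtain v where
      v: "x - 1 < v" "v < x" "x powr (1 + \<alpha>) - (x - 1) powr (1 + \<alpha>) = (1 + \<alpha>) * v powr \<alpha>" by auto
    have "\<exists>z>v. z < u \<and> u powr \<alpha> - v powr \<alpha> = (u - v) * (\<alpha> * z powr (\<alpha> - 1))"
      using u v x by (intro MVT2) (auto intro!: derivative_eq_intros simp: field_simps powr_diff)
    then obtain z where z: "v < z" "z < u" "u powr \<alpha> - v powr \<alpha> = (u - v) * (\<alpha> * z powr (\<alpha> - 1))"
      by blast
    have "z powr (\<alpha> - 1) \<le> ((x + 1) / 3) powr (\<alpha> - 1)"
      using z v x \<alpha> by (intro powr_mono2') auto
    also have "\<dots> = 3 powr (1 - \<alpha>) * (x + 1) powr (\<alpha> - 1)"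
    proof -
      have "3 powr (1 - \<alpha>) = 1 / (3::real) powr (\<alpha> - 1)"
        using powr_minus_divide[of "3::real" "\<alpha> - 1"] by simp
      then show ?thesis using x by (simp add: powr_divide)
    qed
    also have "\<dots> \<le> 3 * (x + 1) powr (\<alpha> - 1)"
      using \<alpha> powr_mono[of "1 - \<alpha>" 1 "3::real"] by (intro mult_right_mono) auto
    finally have zle: "z powr (\<alpha> - 1) \<le> 3 * (x + 1) powr (\<alpha> - 1)" .
    have eq: "(x + 1) powr (1 + \<alpha>) + (x - 1) powr (1 + \<alpha>) - 2 * x powr (1 + \<alpha>)
        = ((1 + \<alpha>) * (u - v) * \<alpha>) * z powr (\<alpha> - 1)" (is "?lhs = _")
    proof -
      have "?lhs = (1 + \<alpha>) * (u powr \<alpha> - v powr \<alpha>)"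
        using u(3) v(3) by (simp add: algebra_simps)
      then show ?thesis unfolding z(3) by (simp add: algebra_simps)
    qed
    have "(1 + \<alpha>) * (u - v) * \<alpha> \<le> 2 * 2 * 1"
      using \<alpha> u v by (intro mult_mono) auto
    then have "?lhs \<le> 4 * (3 * (x + 1) powr (\<alpha> - 1))"
      unfolding eq using zle by (intro mult_mono) auto
    moreover have "0 \<le> ?lhs"
      unfolding eq using \<alpha> u v by simp
    ultimately show ?thesis
      using x by (simp add: x_def add.commute)
  qed
qed

text \<open>The terms depending on a single time point cancel in increments, which leaves a mixed
  second difference of \<open>\<bar>s - t\<bar> powr (1 + \<alpha>)\<close>.\<close>

definition increment_covariance :: "real \<Rightarrow> real \<Rightarrow> real \<Rightarrow> real \<Rightarrow> real \<Rightarrow> real" where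
  "increment_covariance \<alpha> a b a' b' = fbm_const \<alpha> *
     (\<bar>b - a'\<bar> powr (1 + \<alpha>) + \<bar>a - b'\<bar> powr (1 + \<alpha>) - \<bar>b - b'\<bar> powr (1 + \<alpha>) - \<bar>a - a'\<bar> powr (1 + \<alpha>))"

lemma increment_covariance_grid_le:
  fixes i j :: nat
  assumes \<alpha>: "0 < \<alpha>" "\<alpha> < 1" and h: "0 < h"
  shows "\<bar>increment_covariance \<alpha> (real i * h) (real (Suc i) * h) (real j * h) (real (Suc j) * h)\<bar>
    \<le> 12 * \<bar>fbm_const \<alpha>\<bar> * h powr (1 + \<alpha>) * real (1 + nat \<bar>int i - int j\<bar>) powr (\<alpha> - 1)"
proof -
  define k where "k = nat \<bar>int i - int j\<bar>"
  have scale: "\<bar>x * h\<bar> powr (1 + \<alpha>) = h powr (1 + \<alpha>) * \<bar>x\<bar> powr (1 + \<alpha>)" for x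
    using h by (simp add: abs_mult powr_mult)
  let ?x = "real i - real j"
  have "increment_covariance \<alpha> (real i * h) (real (Suc i) * h) (real j * h) (real (Suc j) * h)
      = fbm_const \<alpha> * (\<bar>(?x + 1) * h\<bar> powr (1 + \<alpha>) + \<bar>(?x - 1) * h\<bar> powr (1 + \<alpha>)
          - \<bar>?x * h\<bar> powr (1 + \<alpha>) - \<bar>?x * h\<bar> powr (1 + \<alpha>))"
    unfolding increment_covariance_def by (simp add: algebra_simps)
  also have "\<dots> = fbm_const \<alpha> * h powr (1 + \<alpha>) *
      (\<bar>?x + 1\<bar> powr (1 + \<alpha>) + \<bar>?x - 1\<bar> powr (1 + \<alpha>) - 2 * \<bar>?x\<bar> powr (1 + \<alpha>))"
    unfolding scale by (simp add: algebra_simps)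
  also have "\<bar>?x + 1\<bar> powr (1 + \<alpha>) + \<bar>?x - 1\<bar> powr (1 + \<alpha>) - 2 * \<bar>?x\<bar> powr (1 + \<alpha>) =
      \<bar>real k + 1\<bar> powr (1 + \<alpha>) + \<bar>real k - 1\<bar> powr (1 + \<alpha>) - 2 * real k powr (1 + \<alpha>)"
  proof (cases "j \<le> i")
    case True
    then have "real k = ?x" by (simp add: k_def)
    then show ?thesis using True by simp
  next
    case False
    then have k: "?x = - real k" by (simp add: k_def)
    have "\<bar>- real k + 1\<bar> = \<bar>real k - 1\<bar>" "\<bar>- real k - 1\<bar> = \<bar>real k + 1\<bar>"
      "\<bar>- real k\<bar> = real k" by auto
    then show ?thesis unfolding k by (simp only: add.commute)
  qed
  finally have "\<bar>increment_covariance \<alpha> (real i * h) (real (Suc i) * h) (real j * h) (real (Suc j) * h)\<bar>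
      = \<bar>fbm_const \<alpha>\<bar> * h powr (1 + \<alpha>) * \<bar>\<bar>real k + 1\<bar> powr (1 + \<alpha>) + \<bar>real k - 1\<bar> powr (1 + \<alpha>) - 2 * real k powr (1 + \<alpha>)\<bar>"
    by (simp add: abs_mult)
  also have "\<dots> \<le> \<bar>fbm_const \<alpha>\<bar> * h powr (1 + \<alpha>) * (12 * real (1 + k) powr (\<alpha> - 1))"
    by (intro mult_left_mono second_difference_powr_le \<alpha>) auto
  finally show ?thesis by (simp add: k_def mult_ac)
qed

lemma (in prob_space) gaussian_rv_square_integrable:
  assumes "gaussian_rv M X"
  shows "integrable M (\<lambda>\<omega>. (X \<omega>)\<^sup>2)"
proof -
  have X[measurable]: "X \<in> borel_measurable M" using assms by (simp add: gaussian_rv_def)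
  from assms obtain \<mu> \<sigma> where
    "(\<sigma> > 0 \<and> distributed M lborel X (normal_density \<mu> \<sigma>)) \<or> (AE \<omega> in M. X \<omega> = \<mu>)"
    by (auto simp: gaussian_rv_def)
  then show ?thesis
  proof
    assume *: "\<sigma> > 0 \<and> distributed M lborel X (normal_density \<mu> \<sigma>)"
    then have "integrable lborel (\<lambda>x. normal_density \<mu> \<sigma> x * (x - \<mu>)\<^sup>2)"
      "integrable lborel (\<lambda>x. normal_density \<mu> \<sigma> x * (x - \<mu>) ^ 1)"
      "integrable lborel (\<lambda>x. normal_density \<mu> \<sigma> x * (x - \<mu>) ^ 0)"
      by (intro integrable_normal_moment; simp)+
    then have "integrable lborel (\<lambda>x. normal_density \<mu> \<sigma> x * (x - \<mu>)\<^sup>2 +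
        (2 * \<mu>) * (normal_density \<mu> \<sigma> x * (x - \<mu>) ^ 1) + \<mu>\<^sup>2 * (normal_density \<mu> \<sigma> x * (x - \<mu>) ^ 0))"
      by (intro Bochner_Integration.integrable_add integrable_mult_right)
    also have "(\<lambda>x. normal_density \<mu> \<sigma> x * (x - \<mu>)\<^sup>2 +
        (2 * \<mu>) * (normal_density \<mu> \<sigma> x * (x - \<mu>) ^ 1) + \<mu>\<^sup>2 * (normal_density \<mu> \<sigma> x * (x - \<mu>) ^ 0))
        = (\<lambda>x. normal_density \<mu> \<sigma> x * x\<^sup>2)"
      by (rule ext) (simp add: algebra_simps power2_eq_square)
    finally show ?thesis
      using * by (subst distributed_integrable[symmetric, of _ lborel X "normal_density \<mu> \<sigma>"]) auto
  next
    assume "AE \<omega> in M. X \<omega> = \<mu>"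
    then have "AE \<omega> in M. (X \<omega>)\<^sup>2 = \<mu>\<^sup>2" by eventually_elim simp
    then show ?thesis by (subst integrable_cong_AE[where g = "\<lambda>_. \<mu>\<^sup>2"]) auto
  qed
qed

lemma integrable_mult_of_squares:
  fixes X Y :: "'a \<Rightarrow> real"
  assumes [measurable]: "X \<in> borel_measurable M" "Y \<in> borel_measurable M"
    and "integrable M (\<lambda>\<omega>. (X \<omega>)\<^sup>2)" "integrable M (\<lambda>\<omega>. (Y \<omega>)\<^sup>2)"
  shows "integrable M (\<lambda>\<omega>. X \<omega> * Y \<omega>)"
proof (rule Bochner_Integration.integrable_bound)
  show "integrable M (\<lambda>\<omega>. (X \<omega>)\<^sup>2 + (Y \<omega>)\<^sup>2)" using assms by simp
  have "\<bar>x * y\<bar> \<le> x\<^sup>2 + y\<^sup>2" for x y :: real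
  proof -
    have "2 * (\<bar>x\<bar> * \<bar>y\<bar>) \<le> x\<^sup>2 + y\<^sup>2"
      using sum_squares_bound[of "\<bar>x\<bar>" "\<bar>y\<bar>"] by (simp add: mult.assoc)
    moreover have "0 \<le> \<bar>x\<bar> * \<bar>y\<bar>" by simp
    ultimately show ?thesis unfolding abs_mult by linarith
  qed
  then show "AE \<omega> in M. norm (X \<omega> * Y \<omega>) \<le> norm ((X \<omega>)\<^sup>2 + (Y \<omega>)\<^sup>2)" by simp
qed simp

locale fbm = prob_space M for M :: "'a measure" +
  fixes \<alpha> :: real and \<xi> :: "real \<Rightarrow> 'a \<Rightarrow> real"
  assumes \<alpha>_pos: "0 < \<alpha>" and \<alpha>_less_1: "\<alpha> < 1"
    and fbm: "fractional_brownian_motion M \<alpha> \<xi>"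
begin

lemma measurable_\<xi>: "0 \<le> t \<Longrightarrow> \<xi> t \<in> borel_measurable M"
  using fbm by (simp add: fractional_brownian_motion_def centered_gaussian_process_def)

lemma integrable_\<xi>_mult:
  assumes "0 \<le> s" "0 \<le> t"
  shows "integrable M (\<lambda>\<omega>. \<xi> s \<omega> * \<xi> t \<omega>)"
proof -
  have "gaussian_rv M (\<xi> u)" if "0 \<le> u" for u
  proof -
    have "\<forall>J c. finite J \<and> J \<subseteq> {0..} \<longrightarrow> gaussian_rv M (\<lambda>\<omega>. \<Sum>t\<in>J. c t * \<xi> t \<omega>)"
      using fbm unfolding fractional_brownian_motion_def centered_gaussian_process_def by blast
    from this[rule_format, of "{u}" "\<lambda>_. 1"] that show ?thesis by simp
  qed
  then show ?thesis
    using assms measurable_\<xi> by (intro integrable_mult_of_squares gaussian_rv_square_integrable) auto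
qed

lemma expectation_\<xi>_mult:
  assumes "0 \<le> s" "0 \<le> t"
  shows "expectation (\<lambda>\<omega>. \<xi> s \<omega> * \<xi> t \<omega>) =
    fbm_const \<alpha> * (s powr (1 + \<alpha>) + t powr (1 + \<alpha>) - \<bar>s - t\<bar> powr (1 + \<alpha>))"
  using fbm assms by (simp add: fractional_brownian_motion_def)

lemma increments_mult:
  assumes "0 \<le> a" "0 \<le> b" "0 \<le> a'" "0 \<le> b'"
  shows integrable_increments_mult:
      "integrable M (\<lambda>\<omega>. (\<xi> b \<omega> - \<xi> a \<omega>) * (\<xi> b' \<omega> - \<xi> a' \<omega>))"
    and expectation_increments_mult:
      "expectation (\<lambda>\<omega>. (\<xi> b \<omega> - \<xi> a \<omega>) * (\<xi> b' \<omega> - \<xi> a' \<omega>)) = increment_covariance \<alpha> a b a' b'"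
proof -
  have eq: "(\<lambda>\<omega>. (\<xi> b \<omega> - \<xi> a \<omega>) * (\<xi> b' \<omega> - \<xi> a' \<omega>)) =
     (\<lambda>\<omega>. \<xi> b \<omega> * \<xi> b' \<omega> - \<xi> b \<omega> * \<xi> a' \<omega> - (\<xi> a \<omega> * \<xi> b' \<omega> - \<xi> a \<omega> * \<xi> a' \<omega>))"
    by (rule ext) (simp add: algebra_simps)
  show "integrable M (\<lambda>\<omega>. (\<xi> b \<omega> - \<xi> a \<omega>) * (\<xi> b' \<omega> - \<xi> a' \<omega>))"
    unfolding eq using assms by (intro Bochner_Integration.integrable_diff integrable_\<xi>_mult)
  show "expectation (\<lambda>\<omega>. (\<xi> b \<omega> - \<xi> a \<omega>) * (\<xi> b' \<omega> - \<xi> a' \<omega>)) = increment_covariance \<alpha> a b a' b'"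
    unfolding eq using assms
    by (simp only: Bochner_Integration.integral_diff Bochner_Integration.integrable_diff
          integrable_\<xi>_mult expectation_\<xi>_mult increment_covariance_def) (simp add: right_diff_distrib distrib_left)
qed

lemma weighted_increments_square:
  assumes "finite A" and ab: "\<And>i. i \<in> A \<Longrightarrow> 0 \<le> a i" "\<And>i. i \<in> A \<Longrightarrow> 0 \<le> b i"
  shows integrable_weighted_increments_square:
      "integrable M (\<lambda>\<omega>. (\<Sum>i\<in>A. c i * (\<xi> (b i) \<omega> - \<xi> (a i) \<omega>))\<^sup>2)"
    and expectation_weighted_increments_square:
      "expectation (\<lambda>\<omega>. (\<Sum>i\<in>A. c i * (\<xi> (b i) \<omega> - \<xi> (a i) \<omega>))\<^sup>2) =
        (\<Sum>i\<in>A. \<Sum>j\<in>A. c i * c j * increment_covariance \<alpha> (a i) (b i) (a j) (b j))"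
proof -
  have eq: "(\<lambda>\<omega>. (\<Sum>i\<in>A. c i * (\<xi> (b i) \<omega> - \<xi> (a i) \<omega>))\<^sup>2) =
    (\<lambda>\<omega>. \<Sum>i\<in>A. \<Sum>j\<in>A. c i * c j * ((\<xi> (b i) \<omega> - \<xi> (a i) \<omega>) * (\<xi> (b j) \<omega> - \<xi> (a j) \<omega>)))"
    by (rule ext) (simp add: power2_eq_square sum_product algebra_simps)
  have int: "integrable M (\<lambda>\<omega>. c i * c j * ((\<xi> (b i) \<omega> - \<xi> (a i) \<omega>) * (\<xi> (b j) \<omega> - \<xi> (a j) \<omega>)))"
    if "i \<in> A" "j \<in> A" for i j
    using that ab by (intro integrable_mult_right integrable_increments_mult)
  show "integrable M (\<lambda>\<omega>. (\<Sum>i\<in>A. c i * (\<xi> (b i) \<omega> - \<xi> (a i) \<omega>))\<^sup>2)"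
    unfolding eq using int by (intro Bochner_Integration.integrable_sum)
  have swap: "expectation (\<lambda>\<omega>. \<Sum>i\<in>A. \<Sum>j\<in>A. F i j \<omega>) = (\<Sum>i\<in>A. \<Sum>j\<in>A. expectation (F i j))"
    if "\<And>i j. i \<in> A \<Longrightarrow> j \<in> A \<Longrightarrow> integrable M (F i j)" for F
    using that by simp
  have "expectation (\<lambda>\<omega>. (\<Sum>i\<in>A. c i * (\<xi> (b i) \<omega> - \<xi> (a i) \<omega>))\<^sup>2) =
    (\<Sum>i\<in>A. \<Sum>j\<in>A. expectation (\<lambda>\<omega>. c i * c j * ((\<xi> (b i) \<omega> - \<xi> (a i) \<omega>) * (\<xi> (b j) \<omega> - \<xi> (a j) \<omega>))))"
    unfolding eq using int by (intro swap)
  also have "\<dots> = (\<Sum>i\<in>A. \<Sum>j\<in>A. c i * c j * increment_covariance \<alpha> (a i) (b i) (a j) (b j))"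
    using ab by (intro sum.cong refl) (simp add: expectation_increments_mult)
  finally show "expectation (\<lambda>\<omega>. (\<Sum>i\<in>A. c i * (\<xi> (b i) \<omega> - \<xi> (a i) \<omega>))\<^sup>2) =
        (\<Sum>i\<in>A. \<Sum>j\<in>A. c i * c j * increment_covariance \<alpha> (a i) (b i) (a j) (b j))" .
qed

end

section \<open>Elementary integrals and the fundamental estimate\<close>

text \<open>The intervals may overlap. Differences of elementary integrals over unrelated
  partitions are therefore again elementary, without passing to a common refinement, which
  need not be an equidistant grid.\<close>

definition elementary_integral ::
    "(real \<Rightarrow> 'a \<Rightarrow> real) \<Rightarrow> (real \<Rightarrow> real) \<Rightarrow> ('a \<Rightarrow> real) \<Rightarrow> bool" where
  "elementary_integral \<xi> g X \<longleftrightarrow> (\<exists>(n::nat) a b c.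
     (\<forall>i<n. 0 \<le> a i \<and> a i \<le> b i) \<and>
     g = (\<lambda>x. \<Sum>i<n. c i * indicator {a i..<b i} x) \<and>
     X = (\<lambda>\<omega>. \<Sum>i<n. c i * (\<xi> (b i) \<omega> - \<xi> (a i) \<omega>)))"

lemma elementary_integralI:
  assumes "\<And>i. i < n \<Longrightarrow> 0 \<le> a i \<and> a i \<le> b i"
  shows "elementary_integral \<xi> (\<lambda>x. \<Sum>i<(n::nat). c i * indicator {a i..<b i} x)
           (\<lambda>\<omega>. \<Sum>i<n. c i * (\<xi> (b i) \<omega> - \<xi> (a i) \<omega>))"
  unfolding elementary_integral_def using assms by blast

lemma elementary_integral_zero: "elementary_integral \<xi> (\<lambda>_. 0) (\<lambda>_. 0)"
  using elementary_integralI[of 0] by simp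

lemma elementary_integral_diff:
  assumes "elementary_integral \<xi> g X" "elementary_integral \<xi> h Y"
  shows "elementary_integral \<xi> (\<lambda>x. g x - h x) (\<lambda>\<omega>. X \<omega> - Y \<omega>)"
proof -
  from assms(1) obtain n :: nat and a b c where 1: "\<And>i. i < n \<Longrightarrow> 0 \<le> a i \<and> a i \<le> b i"
    "g = (\<lambda>x. \<Sum>i<n. c i * indicator {a i..<b i} x)"
    "X = (\<lambda>\<omega>. \<Sum>i<n. c i * (\<xi> (b i) \<omega> - \<xi> (a i) \<omega>))"
    unfolding elementary_integral_def by blast
  from assms(2) obtain m :: nat and a' b' c' where 2: "\<And>i. i < m \<Longrightarrow> 0 \<le> a' i \<and> a' i \<le> b' i"
    "h = (\<lambda>x. \<Sum>i<m. c' i * indicator {a' i..<b' i} x)"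
    "Y = (\<lambda>\<omega>. \<Sum>i<m. c' i * (\<xi> (b' i) \<omega> - \<xi> (a' i) \<omega>))"
    unfolding elementary_integral_def by blast
  have split: "(\<Sum>i<n + m. if i < n then F i else - G (i - n)) = (\<Sum>i<n. F i) - (\<Sum>i<m. G i)"
    for F G :: "nat \<Rightarrow> real"
  proof -
    have "(\<Sum>i<n + m. if i < n then F i else - G (i - n)) =
        (\<Sum>i<n. if i < n then F i else - G (i - n)) + (\<Sum>i=n..<n + m. if i < n then F i else - G (i - n))"
      using sum.atLeastLessThan_concat[of 0 n "n + m" "\<lambda>i. if i < n then F i else - G (i - n)"]
      by (simp add: lessThan_atLeast0)
    also have "(\<Sum>i=n..<n + m. if i < n then F i else - G (i - n)) = (\<Sum>i=0..<m. - G i)"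
      using sum.shift_bounds_nat_ivl[of "\<lambda>i. if i < n then F i else - G (i - n)" 0 n m]
      by (simp add: add.commute)
    finally show ?thesis by (simp add: sum_negf lessThan_atLeast0)
  qed
  define A B C where "A i = (if i < n then a i else a' (i - n))"
    and "B i = (if i < n then b i else b' (i - n))"
    and "C i = (if i < n then c i else - c' (i - n))" for i
  have "(\<lambda>x. g x - h x) = (\<lambda>x. \<Sum>i<n + m. C i * indicator {A i..<B i} x)"
    unfolding 1 2 split[symmetric] by (intro ext sum.cong) (auto simp: A_def B_def C_def)
  moreover have "(\<lambda>\<omega>. X \<omega> - Y \<omega>) = (\<lambda>\<omega>. \<Sum>i<n + m. C i * (\<xi> (B i) \<omega> - \<xi> (A i) \<omega>))"
    unfolding 1 2 split[symmetric] by (intro ext sum.cong) (auto simp: A_def B_def C_def)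
  moreover have "0 \<le> A i \<and> A i \<le> B i" if "i < n + m" for i
    using that 1(1)[of i] 2(1)[of "i - n"] by (auto simp: A_def B_def)
  ultimately show ?thesis using elementary_integralI[of "n + m" A B \<xi> C] by simp
qed

lemma step_function_powr_le:
  fixes a b c :: "nat \<Rightarrow> real"
  assumes "0 < q" and ab: "\<And>i. i < n \<Longrightarrow> 0 \<le> a i" "\<And>i. i < n \<Longrightarrow> b i \<le> B"
  shows "\<bar>\<Sum>i<n. c i * indicator {a i..<b i} x\<bar> powr q \<le> (\<Sum>i<n. \<bar>c i\<bar>) powr q * indicator {0..B} x"
proof (cases "x \<in> {0..B}")
  case True
  have "\<bar>\<Sum>i<n. c i * indicator {a i..<b i} x\<bar> \<le> (\<Sum>i<n. \<bar>c i\<bar>)"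
    by (intro order_trans[OF sum_abs] sum_mono) (auto simp: indicator_def)
  then show ?thesis using True assms(1) by (simp add: powr_mono2)
next
  case False
  have "(\<Sum>i<n. c i * indicator {a i..<b i} x) = 0"
  proof (intro sum.neutral ballI)
    fix i assume "i \<in> {..<n}"
    then show "c i * indicator {a i..<b i} x = 0"
      using False ab(1)[of i] ab(2)[of i] by (auto simp: indicator_def)
  qed
  then show ?thesis using False by simp
qed

lemma elementary_integral_measurable:
  assumes "elementary_integral \<xi> g X"
  shows "g \<in> borel_measurable borel"
proof -
  from assms obtain n :: nat and a b c where g: "g = (\<lambda>x. \<Sum>i<n. c i * indicator {a i..<b i} x)"
    unfolding elementary_integral_def by blast
  show ?thesis unfolding g by measurable
qed

definition round_down :: "real \<Rightarrow> real \<Rightarrow> real" where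
  "round_down h x = real (nat \<lfloor>x / h\<rfloor>) * h"

lemma round_down_bounds:
  assumes "0 < h" "0 \<le> x"
  shows "round_down h x \<le> x" "x - h < round_down h x" "0 \<le> round_down h x"
proof -
  have "real (nat \<lfloor>x / h\<rfloor>) \<le> x / h" "x / h < real (nat \<lfloor>x / h\<rfloor>) + 1"
    using assms by auto
  then have "real (nat \<lfloor>x / h\<rfloor>) * h \<le> x" "x < (real (nat \<lfloor>x / h\<rfloor>) + 1) * h"
    using assms(1) by (simp_all only: pos_le_divide_eq pos_divide_less_eq)
  then show "round_down h x \<le> x" "x - h < round_down h x" "0 \<le> round_down h x"
    using assms by (auto simp: round_down_def distrib_right)
qed

lemma multiple_le_iff:
  assumes "0 < h" "0 \<le> x"
  shows "real m * h \<le> x \<longleftrightarrow> m \<le> nat \<lfloor>x / h\<rfloor>"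
proof -
  have "real m * h \<le> x \<longleftrightarrow> real m \<le> x / h"
    using assms(1) by (simp only: pos_le_divide_eq)
  also have "\<dots> \<longleftrightarrow> m \<le> nat \<lfloor>x / h\<rfloor>"
    using assms by (simp add: le_nat_iff le_floor_iff)
  finally show ?thesis .
qed

lemma round_down_tendsto:
  assumes "0 \<le> x"
  shows "(\<lambda>n. round_down (inverse (real (Suc n))) x) \<longlonglongrightarrow> x"
proof (rule tendsto_sandwich)
  show "\<forall>\<^sub>F n in sequentially. x - inverse (real (Suc n)) \<le> round_down (inverse (real (Suc n))) x"
    using round_down_bounds(2)[OF _ assms] by (intro always_eventually allI less_imp_le) simp
  show "\<forall>\<^sub>F n in sequentially. round_down (inverse (real (Suc n))) x \<le> x"
    using round_down_bounds(1)[OF _ assms] by (intro always_eventually allI) simp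
  show "(\<lambda>n. x - inverse (real (Suc n))) \<longlonglongrightarrow> x"
    using tendsto_diff[OF tendsto_const LIMSEQ_inverse_real_of_nat] by simp
qed simp

text \<open>Half-open intervals are stable under rounding their endpoints down, even at the
  endpoints themselves.\<close>

lemma indicator_round_down_tendsto:
  assumes "0 \<le> a" "0 \<le> b"
  shows "(\<lambda>n. indicator {round_down (inverse (real (Suc n))) a..<round_down (inverse (real (Suc n))) b} x)
           \<longlonglongrightarrow> (indicator {a..<b} x :: real)"
proof -
  let ?r = "\<lambda>n. round_down (inverse (real (Suc n)))"
  have le: "?r n a \<le> a" "?r n b \<le> b" for n using round_down_bounds(1) assms by auto
  have a: "\<forall>\<^sub>F n in sequentially. ?r n a \<le> x \<longleftrightarrow> a \<le> x"
  proof (cases "a \<le> x")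
    case True
    then show ?thesis using le order_trans by (intro always_eventually) blast
  next
    case False
    with order_tendstoD(1)[OF round_down_tendsto[OF assms(1)], of x]
    show ?thesis by (auto elim: eventually_mono)
  qed
  have b: "\<forall>\<^sub>F n in sequentially. x < ?r n b \<longleftrightarrow> x < b"
  proof (cases "x < b")
    case True
    with order_tendstoD(1)[OF round_down_tendsto[OF assms(2)], of x]
    show ?thesis by (auto elim: eventually_mono)
  next
    case False
    then show ?thesis using le less_le_trans by (intro always_eventually) blast
  qed
  from a b have "\<forall>\<^sub>F n in sequentially. indicator {?r n a..<?r n b} x = (indicator {a..<b} x :: real)"
    by eventually_elim (auto simp: indicator_def)
  then show ?thesis by (rule tendsto_eventually)
qed

lemma tendsto_abs_powr:
  fixes f :: "'b \<Rightarrow> real"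
  assumes "(f \<longlongrightarrow> l) F" "0 < q"
  shows "((\<lambda>x. \<bar>f x\<bar> powr q) \<longlongrightarrow> \<bar>l\<bar> powr q) F"
  using assms by (intro tendsto_powr' tendsto_rabs tendsto_const) auto

context fbm
begin

definition p :: real where "p = 2 / (1 + \<alpha>)"

lemma p_gt_1: "1 < p" and p_pos: "0 < p" and p_mult: "p * (1 + \<alpha>) = 2"
  using \<alpha>_pos \<alpha>_less_1 by (auto simp: p_def field_simps)

text \<open>The product of the constants in the covariance bound on a grid and in the discrete
  Hardy--Littlewood--Sobolev inequality.\<close>

definition K :: real where "K = 12 * \<bar>fbm_const \<alpha>\<bar> * (2 * (8 / \<alpha> + 3))"

lemma K_nonneg: "0 \<le> K"
  using \<alpha>_pos by (simp add: K_def)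

text \<open>The mesh \<open>h\<close> enters both sides with the power \<open>1 + \<alpha>\<close>. This scaling singles out the
  exponent \<open>p\<close> and makes the constant independent of the grid.\<close>

lemma grid_integral_bound:
  assumes h: "0 < h"
  shows "expectation (\<lambda>\<omega>. (\<Sum>j<N. d j * (\<xi> (real (Suc j) * h) \<omega> - \<xi> (real j * h) \<omega>))\<^sup>2)
    \<le> K * (\<Sum>j<N. \<bar>d j\<bar> powr p * h) powr (1 + \<alpha>)"
proof -
  let ?w = "\<lambda>i j. real (1 + nat \<bar>int i - int j\<bar>) powr (\<alpha> - 1)"
  let ?g = "\<lambda>i j. increment_covariance \<alpha> (real i * h) (real (Suc i) * h) (real j * h) (real (Suc j) * h)"
  let ?B = "12 * \<bar>fbm_const \<alpha>\<bar> * h powr (1 + \<alpha>)"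
  have "expectation (\<lambda>\<omega>. (\<Sum>j<N. d j * (\<xi> (real (Suc j) * h) \<omega> - \<xi> (real j * h) \<omega>))\<^sup>2)
      = (\<Sum>i<N. \<Sum>j<N. d i * d j * ?g i j)"
    using h by (intro expectation_weighted_increments_square) auto
  also have "\<dots> \<le> (\<Sum>i<N. \<Sum>j<N. ?B * (\<bar>d i\<bar> * \<bar>d j\<bar> * ?w i j))"
  proof (intro sum_mono)
    fix i j
    have "d i * d j * ?g i j \<le> \<bar>d i\<bar> * \<bar>d j\<bar> * \<bar>?g i j\<bar>"
      by (simp add: abs_mult[symmetric])
    also have "\<dots> \<le> \<bar>d i\<bar> * \<bar>d j\<bar> * (?B * ?w i j)"
      by (intro mult_left_mono increment_covariance_grid_le \<alpha>_pos \<alpha>_less_1 h) auto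
    finally show "d i * d j * ?g i j \<le> ?B * (\<bar>d i\<bar> * \<bar>d j\<bar> * ?w i j)"
      by (simp only: mult_ac)
  qed
  also have "\<dots> = ?B * (\<Sum>i<N. \<Sum>j<N. \<bar>d i\<bar> * \<bar>d j\<bar> * ?w i j)"
    by (simp only: sum_distrib_left)
  also have "\<dots> \<le> ?B * (2 * (8 / \<alpha> + 3) * (\<Sum>j<N. \<bar>d j\<bar> powr p) powr (1 + \<alpha>))"
    unfolding p_def by (intro mult_left_mono discrete_HLS \<alpha>_pos \<alpha>_less_1) auto
  also have "\<dots> = K * (\<Sum>j<N. \<bar>d j\<bar> powr p * h) powr (1 + \<alpha>)"
    using h by (simp add: K_def sum_distrib_right[symmetric] powr_mult sum_nonneg)
  finally show ?thesis .
qed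

text \<open>If all endpoints are multiples of \<open>h\<close>, telescoping turns the elementary integral into
  one over the grid cells \<open>[j h, (j + 1) h)\<close>.\<close>

lemma elementary_integral_bound_grid:
  fixes k l :: "nat \<Rightarrow> nat"
  assumes h: "0 < h" and kl: "\<And>i. i < n \<Longrightarrow> k i \<le> l i"
  shows "expectation (\<lambda>\<omega>. (\<Sum>i<n. c i * (\<xi> (real (l i) * h) \<omega> - \<xi> (real (k i) * h) \<omega>))\<^sup>2)
    \<le> K * (LINT x|lborel. \<bar>\<Sum>i<n. c i * indicator {real (k i) * h..<real (l i) * h} x\<bar> powr p) powr (1 + \<alpha>)"
proof -
  define N where "N = Max (insert 0 (l ` {..<n}))"
  have N: "l i \<le> N" if "i < n" for i
    using that by (auto simp: N_def)
  define d where "d j = (\<Sum>i<n. c i * indicator {k i..<l i} j)" for j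
  have d0: "d j = 0" if "N \<le> j" for j
    using that N unfolding d_def by (intro sum.neutral) (fastforce simp: indicator_def)
  have tele: "\<xi> (real (l i) * h) \<omega> - \<xi> (real (k i) * h) \<omega> =
      (\<Sum>j<N. indicator {k i..<l i} j * (\<xi> (real (Suc j) * h) \<omega> - \<xi> (real j * h) \<omega>))" if "i < n" for i \<omega>
  proof -
    have "\<xi> (real (l i) * h) \<omega> - \<xi> (real (k i) * h) \<omega> =
        (\<Sum>j = k i..<l i. \<xi> (real (Suc j) * h) \<omega> - \<xi> (real j * h) \<omega>)"
      using kl[OF that] by (subst sum_Suc_diff') auto
    also have "\<dots> = (\<Sum>j<N. indicator {k i..<l i} j * (\<xi> (real (Suc j) * h) \<omega> - \<xi> (real j * h) \<omega>))"
      using N[OF that] by (intro sum.mono_neutral_cong_left) (auto simp: indicator_def)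
    finally show ?thesis .
  qed
  have "(\<Sum>i<n. c i * (\<xi> (real (l i) * h) \<omega> - \<xi> (real (k i) * h) \<omega>)) =
      (\<Sum>j<N. d j * (\<xi> (real (Suc j) * h) \<omega> - \<xi> (real j * h) \<omega>))" for \<omega>
  proof -
    have "(\<Sum>i<n. c i * (\<xi> (real (l i) * h) \<omega> - \<xi> (real (k i) * h) \<omega>)) =
      (\<Sum>i<n. \<Sum>j<N. c i * indicator {k i..<l i} j * (\<xi> (real (Suc j) * h) \<omega> - \<xi> (real j * h) \<omega>))"
      by (intro sum.cong refl) (simp only: tele lessThan_iff sum_distrib_left mult.assoc)
    also have "\<dots> = (\<Sum>j<N. \<Sum>i<n. c i * indicator {k i..<l i} j * (\<xi> (real (Suc j) * h) \<omega> - \<xi> (real j * h) \<omega>))"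
      by (rule sum.swap)
    finally show ?thesis by (simp only: d_def sum_distrib_right)
  qed
  then have "expectation (\<lambda>\<omega>. (\<Sum>i<n. c i * (\<xi> (real (l i) * h) \<omega> - \<xi> (real (k i) * h) \<omega>))\<^sup>2)
      \<le> K * (\<Sum>j<N. \<bar>d j\<bar> powr p * h) powr (1 + \<alpha>)"
    using grid_integral_bound[OF h, of d N] by simp
  also have "(\<Sum>j<N. \<bar>d j\<bar> powr p * h) =
      (LINT x|lborel. (\<Sum>j<N. \<bar>d j\<bar> powr p * indicator {real j * h..<real (Suc j) * h} x))"
  proof -
    have len: "real j * h \<le> real (Suc j) * h" "real (Suc j) * h - real j * h = h" for j
      using h by (simp_all add: distrib_right)
    have "integrable lborel (\<lambda>x. \<bar>d j\<bar> powr p * indicator {real j * h..<real (Suc j) * h} x)"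
      "(LINT x|lborel. \<bar>d j\<bar> powr p * indicator {real j * h..<real (Suc j) * h} x) = \<bar>d j\<bar> powr p * h" for j
      using len[of j] by (auto simp del: of_nat_Suc simp: integrable_real_indicator)
    then show ?thesis by (subst Bochner_Integration.integral_sum) (simp_all only:)
  qed
  also have "(\<lambda>x. \<Sum>j<N. \<bar>d j\<bar> powr p * indicator {real j * h..<real (Suc j) * h} x) =
      (\<lambda>x. \<bar>\<Sum>i<n. c i * indicator {real (k i) * h..<real (l i) * h} x\<bar> powr p)"
  proof
    fix x :: real
    show "(\<Sum>j<N. \<bar>d j\<bar> powr p * indicator {real j * h..<real (Suc j) * h} x) =
      \<bar>\<Sum>i<n. c i * indicator {real (k i) * h..<real (l i) * h} x\<bar> powr p"
    proof (cases "0 \<le> x")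
      case False
      then have "x < real j * h" for j using h by (smt (verit) mult_nonneg_nonneg of_nat_0_le_iff)
      then have "indicator {real j * h..<y} x = (0::real)" for j y by (auto simp: indicator_def not_le)
      then show ?thesis by simp
    next
      case True
      define r where "r = nat \<lfloor>x / h\<rfloor>"
      have iff: "real m * h \<le> x \<longleftrightarrow> m \<le> r" for m
        unfolding r_def using h True by (rule multiple_le_iff)
      have ind: "indicator {real m * h..<real m' * h} x = (indicator {m..<m'} r :: real)" for m m'
        using iff[of m] iff[of m'] by (auto simp: indicator_def not_le[symmetric])
      have "(\<Sum>j<N. \<bar>d j\<bar> powr p * indicator {real j * h..<real (Suc j) * h} x) =
          (\<Sum>j<N. if j = r then \<bar>d j\<bar> powr p else 0)"
        unfolding ind by (intro sum.cong) (auto simp: indicator_def)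
      also have "\<dots> = \<bar>d r\<bar> powr p" using d0[of r] by simp
      also have "d r = (\<Sum>i<n. c i * indicator {real (k i) * h..<real (l i) * h} x)"
        unfolding ind d_def ..
      finally show ?thesis .
    qed
  qed
  finally show ?thesis .
qed

text \<open>Arbitrary endpoints are rounded down to a grid whose mesh tends to 0. Both sides of the estimate
  are continuous in the endpoints: the left one because it is a finite combination of
  covariances, the right one by dominated convergence.\<close>

theorem elementary_integral_bound:
  assumes "elementary_integral \<xi> g X"
  shows "expectation (\<lambda>\<omega>. (X \<omega>)\<^sup>2) \<le> K * (LINT x|lborel. \<bar>g x\<bar> powr p) powr (1 + \<alpha>)"
proof -
  from assms obtain n :: nat and a b c where ab: "\<And>i. i < n \<Longrightarrow> 0 \<le> a i \<and> a i \<le> b i"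
    and g: "g = (\<lambda>x. \<Sum>i<n. c i * indicator {a i..<b i} x)"
    and X: "X = (\<lambda>\<omega>. \<Sum>i<n. c i * (\<xi> (b i) \<omega> - \<xi> (a i) \<omega>))"
    unfolding elementary_integral_def by blast
  have b0: "0 \<le> b i" if "i < n" for i using ab[OF that] by linarith
  let ?h = "\<lambda>m. inverse (real (Suc m))"
  let ?g = "\<lambda>m x. \<Sum>i<n. c i * indicator {round_down (?h m) (a i)..<round_down (?h m) (b i)} x"
  let ?X = "\<lambda>m \<omega>. \<Sum>i<n. c i * (\<xi> (round_down (?h m) (b i)) \<omega> - \<xi> (round_down (?h m) (a i)) \<omega>)"
  have rd0: "0 \<le> round_down (?h m) x" for m x by (simp add: round_down_def)
  have bound: "expectation (\<lambda>\<omega>. (?X m \<omega>)\<^sup>2) \<le> K * (LINT x|lborel. \<bar>?g m x\<bar> powr p) powr (1 + \<alpha>)" for m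
    unfolding round_down_def
    using ab by (intro elementary_integral_bound_grid)
      (auto intro!: nat_mono floor_mono mult_right_mono simp: divide_inverse)
  have E: "expectation (\<lambda>\<omega>. (\<Sum>i<n. c i * (\<xi> (v i) \<omega> - \<xi> (u i) \<omega>))\<^sup>2) =
      (\<Sum>i<n. \<Sum>j<n. c i * c j * increment_covariance \<alpha> (u i) (v i) (u j) (v j))"
    if "\<And>i. i < n \<Longrightarrow> 0 \<le> u i" "\<And>i. i < n \<Longrightarrow> 0 \<le> v i" for u v
    using that by (intro expectation_weighted_increments_square) auto
  have lim_left: "(\<lambda>m. expectation (\<lambda>\<omega>. (?X m \<omega>)\<^sup>2)) \<longlonglongrightarrow> expectation (\<lambda>\<omega>. (X \<omega>)\<^sup>2)"
  proof -
    have "(\<lambda>m. \<Sum>i<n. \<Sum>j<n. c i * c j * increment_covariance \<alpha> (round_down (?h m) (a i))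
          (round_down (?h m) (b i)) (round_down (?h m) (a j)) (round_down (?h m) (b j)))
        \<longlonglongrightarrow> (\<Sum>i<n. \<Sum>j<n. c i * c j * increment_covariance \<alpha> (a i) (b i) (a j) (b j))"
      unfolding increment_covariance_def using ab b0 \<alpha>_pos
      by (intro tendsto_sum tendsto_mult tendsto_const tendsto_diff tendsto_add tendsto_abs_powr
          round_down_tendsto) auto
    then show ?thesis
      unfolding X using ab b0 rd0 by (simp add: E)
  qed
  have lim_right: "(\<lambda>m. LINT x|lborel. \<bar>?g m x\<bar> powr p) \<longlonglongrightarrow> (LINT x|lborel. \<bar>g x\<bar> powr p)"
  proof (rule integral_dominated_convergence)
    define C where "C = (\<Sum>i<n. \<bar>c i\<bar>)"
    define B where "B = Max (insert 0 (b ` {..<n}))"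
    have B: "b i \<le> B" if "i < n" for i using that by (auto simp: B_def)
    show "integrable lborel (\<lambda>x. C powr p * indicator {0..B} x)"
      by (intro integrable_mult_right integrable_real_indicator) (auto simp: emeasure_lborel_Icc_eq)
    show "AE x in lborel. (\<lambda>m. \<bar>?g m x\<bar> powr p) \<longlonglongrightarrow> \<bar>g x\<bar> powr p"
      unfolding g using ab b0 p_pos
      by (intro AE_I2 tendsto_abs_powr tendsto_sum tendsto_mult tendsto_const
          indicator_round_down_tendsto) auto
    have "round_down (?h m) (b i) \<le> B" if "i < n" for m i
      using round_down_bounds(1)[of "?h m" "b i"] B[OF that] b0[OF that] by simp
    then have "\<bar>?g m x\<bar> powr p \<le> C powr p * indicator {0..B} x" for m x
      unfolding C_def using p_pos rd0 by (intro step_function_powr_le) auto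
    then show "AE x in lborel. norm (\<bar>?g m x\<bar> powr p) \<le> C powr p * indicator {0..B} x" for m
      by simp
    show "(\<lambda>x. \<bar>g x\<bar> powr p) \<in> borel_measurable lborel"
      unfolding g by measurable
    show "(\<lambda>x. \<bar>?g m x\<bar> powr p) \<in> borel_measurable lborel" for m
      by measurable
  qed
  have "(\<lambda>m. K * (LINT x|lborel. \<bar>?g m x\<bar> powr p) powr (1 + \<alpha>))
      \<longlonglongrightarrow> K * (LINT x|lborel. \<bar>g x\<bar> powr p) powr (1 + \<alpha>)"
    using \<alpha>_pos by (intro tendsto_mult tendsto_const tendsto_powr' lim_right)
      (auto intro!: always_eventually)
  with lim_left show ?thesis
    using bound by (intro LIMSEQ_le) auto
qed

lemma elementary_integral_square_integrable:
  assumes "elementary_integral \<xi> g X"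
  shows "X \<in> borel_measurable M" "integrable M (\<lambda>\<omega>. (X \<omega>)\<^sup>2)"
proof -
  from assms obtain n :: nat and a b c where ab: "\<And>i. i < n \<Longrightarrow> 0 \<le> a i \<and> a i \<le> b i"
    and X: "X = (\<lambda>\<omega>. \<Sum>i<n. c i * (\<xi> (b i) \<omega> - \<xi> (a i) \<omega>))"
    unfolding elementary_integral_def by blast
  have b0: "0 \<le> b i" if "i < n" for i using ab[OF that] by linarith
  show "X \<in> borel_measurable M"
    unfolding X using ab b0
    by (intro borel_measurable_sum borel_measurable_times borel_measurable_diff measurable_\<xi>) auto
  show "integrable M (\<lambda>\<omega>. (X \<omega>)\<^sup>2)"
    unfolding X using ab b0 by (intro integrable_weighted_increments_square) auto
qed

end

section \<open>Mean convergence of order \<open>p\<close>\<close>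

lemma abs_diff_powr_le:
  fixes x y q :: real
  assumes "0 < q"
  shows "\<bar>x - y\<bar> powr q \<le> 2 powr q * (\<bar>x\<bar> powr q + \<bar>y\<bar> powr q)"
proof -
  have "\<bar>x - y\<bar> powr q \<le> (2 * max \<bar>x\<bar> \<bar>y\<bar>) powr q"
    using assms by (intro powr_mono2) auto
  also have "\<dots> = 2 powr q * (max \<bar>x\<bar> \<bar>y\<bar>) powr q"
    by (simp add: powr_mult)
  also have "(max \<bar>x\<bar> \<bar>y\<bar>) powr q \<le> \<bar>x\<bar> powr q + \<bar>y\<bar> powr q"
    by (auto simp: max_def)
  finally show ?thesis by simp
qed

lemma in_Lp_diff:
  assumes "0 < q" "in_Lp q M f" "in_Lp q M g"
  shows "in_Lp q M (\<lambda>x. f x - g x)"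
  unfolding in_Lp_def
proof
  have [measurable]: "f \<in> borel_measurable M" "g \<in> borel_measurable M"
    using assms by (auto simp: in_Lp_def)
  show "(\<lambda>x. f x - g x) \<in> borel_measurable M" by simp
  show "integrable M (\<lambda>x. \<bar>f x - g x\<bar> powr q)"
  proof (rule Bochner_Integration.integrable_bound)
    show "integrable M (\<lambda>x. 2 powr q * (\<bar>f x\<bar> powr q + \<bar>g x\<bar> powr q))"
      using assms by (auto simp: in_Lp_def)
    show "AE x in M. norm (\<bar>f x - g x\<bar> powr q) \<le> norm (2 powr q * (\<bar>f x\<bar> powr q + \<bar>g x\<bar> powr q))"
      using abs_diff_powr_le[OF assms(1)] by (auto simp: abs_mult)
  qed simp
qed

text \<open>Comparing \<open>q\<close>-th means instead of norms avoids roots and Minkowski's inequality, at the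
  price of the factor \<open>2 powr q\<close>.\<close>

lemma integral_abs_diff_powr_triangle:
  assumes q: "0 < q" and f: "in_Lp q M f" and g: "in_Lp q M g" and h: "in_Lp q M h"
  shows "(LINT x|M. \<bar>f x - h x\<bar> powr q) \<le>
    2 powr q * ((LINT x|M. \<bar>g x - f x\<bar> powr q) + (LINT x|M. \<bar>g x - h x\<bar> powr q))"
proof -
  have int: "integrable M (\<lambda>x. \<bar>f x - h x\<bar> powr q)" "integrable M (\<lambda>x. \<bar>g x - f x\<bar> powr q)"
    "integrable M (\<lambda>x. \<bar>g x - h x\<bar> powr q)"
    using in_Lp_diff[OF q] f g h by (auto simp: in_Lp_def)
  have "(LINT x|M. \<bar>f x - h x\<bar> powr q) \<le>
      (LINT x|M. 2 powr q * (\<bar>g x - f x\<bar> powr q + \<bar>g x - h x\<bar> powr q))"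
  proof (rule integral_mono)
    show "\<bar>f x - h x\<bar> powr q \<le> 2 powr q * (\<bar>g x - f x\<bar> powr q + \<bar>g x - h x\<bar> powr q)" for x
      using abs_diff_powr_le[OF q, of "g x - h x" "g x - f x"] by (simp add: add.commute)
  qed (use int in auto)
  then show ?thesis using int by simp
qed

lemma tendsto_in_Lp_iff:
  assumes q: "0 < q"
  shows "tendsto_in_Lp q M F f \<longleftrightarrow> (\<forall>n. in_Lp q M (F n)) \<and> in_Lp q M f \<and>
    (\<lambda>n. LINT x|M. \<bar>F n x - f x\<bar> powr q) \<longlonglongrightarrow> 0"
proof -
  let ?I = "\<lambda>n. LINT x|M. \<bar>F n x - f x\<bar> powr q"
  have I0: "0 \<le> ?I n" for n by simp
  have "(\<lambda>n. ?I n powr (1 / q)) \<longlonglongrightarrow> 0" if "?I \<longlonglongrightarrow> 0"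
    using tendsto_powr'[OF that tendsto_const, of "1 / q"] q I0
    by (auto intro: always_eventually)
  moreover have "?I \<longlonglongrightarrow> 0" if "(\<lambda>n. ?I n powr (1 / q)) \<longlonglongrightarrow> 0"
  proof -
    have "(\<lambda>n. (?I n powr (1 / q)) powr q) \<longlonglongrightarrow> 0"
      using tendsto_powr'[OF that tendsto_const, of q] q by auto
    then show ?thesis using I0 q by (simp add: powr_powr)
  qed
  ultimately show ?thesis by (auto simp: tendsto_in_Lp_def Lp_norm_def)
qed

lemma abs_powr_2: "\<bar>x :: real\<bar> powr 2 = x\<^sup>2"
  by (cases "x = 0") (simp_all add: powr_numeral)

lemma in_Lp_2_iff: "in_Lp 2 M X \<longleftrightarrow> X \<in> borel_measurable M \<and> integrable M (\<lambda>\<omega>. (X \<omega>)\<^sup>2)"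
  unfolding in_Lp_def abs_powr_2 ..

lemma square_triangle:
  fixes X Y Z :: "'a \<Rightarrow> real"
  assumes X: "in_Lp 2 M X" and Y: "in_Lp 2 M Y" and Z: "in_Lp 2 M Z"
  shows "(LINT \<omega>|M. (X \<omega> - Z \<omega>)\<^sup>2) \<le> 2 * (LINT \<omega>|M. (Y \<omega> - X \<omega>)\<^sup>2) + 2 * (LINT \<omega>|M. (Y \<omega> - Z \<omega>)\<^sup>2)"
proof -
  have int: "integrable M (\<lambda>x. (X x - Z x)\<^sup>2)" "integrable M (\<lambda>x. (Y x - X x)\<^sup>2)"
    "integrable M (\<lambda>x. (Y x - Z x)\<^sup>2)"
    using in_Lp_diff[of 2 M] X Y Z by (auto simp: in_Lp_2_iff)
  have "(LINT \<omega>|M. (X \<omega> - Z \<omega>)\<^sup>2) \<le> (LINT \<omega>|M. 2 * (Y \<omega> - X \<omega>)\<^sup>2 + 2 * (Y \<omega> - Z \<omega>)\<^sup>2)"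
  proof (rule integral_mono)
    fix \<omega>
    have "0 \<le> ((Y \<omega> - X \<omega>) + (Y \<omega> - Z \<omega>))\<^sup>2" by simp
    then show "(X \<omega> - Z \<omega>)\<^sup>2 \<le> 2 * (Y \<omega> - X \<omega>)\<^sup>2 + 2 * (Y \<omega> - Z \<omega>)\<^sup>2"
      by (simp add: power2_eq_square algebra_simps)
  qed (use int in auto)
  then show ?thesis using int by simp
qed

text \<open>Since \<open>\<bar>x\<bar> \<le> (1/2) ^ k + 2 ^ k * x\<^sup>2\<close>, a geometric bound on second moments gives almost
  sure absolute summability.\<close>

lemma AE_summable_of_second_moments:
  fixes D :: "nat \<Rightarrow> 'a \<Rightarrow> real"
  assumes D: "\<And>k. in_Lp 2 M (D k)" and bound: "\<And>k. (LINT \<omega>|M. (D k \<omega>)\<^sup>2) \<le> (1/4) ^ k"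
  shows "AE \<omega> in M. summable (\<lambda>k. \<bar>D k \<omega>\<bar>)"
proof -
  have [measurable]: "D k \<in> borel_measurable M" for k using D by (simp add: in_Lp_2_iff)
  have int: "integrable M (\<lambda>\<omega>. (D k \<omega>)\<^sup>2)" for k using D by (simp add: in_Lp_2_iff)
  have weighted: "(\<integral>\<^sup>+\<omega>. ennreal (2 ^ k * (D k \<omega>)\<^sup>2) \<partial>M) \<le> ennreal ((1/2) ^ k)" for k
  proof -
    have "(\<integral>\<^sup>+\<omega>. ennreal (2 ^ k * (D k \<omega>)\<^sup>2) \<partial>M) = ennreal (LINT \<omega>|M. 2 ^ k * (D k \<omega>)\<^sup>2)"
      using int by (intro nn_integral_eq_integral) auto
    also have "(LINT \<omega>|M. 2 ^ k * (D k \<omega>)\<^sup>2) \<le> 2 ^ k * (1/4) ^ k"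
      using bound[of k] by simp
    also have "2 ^ k * (1/4) ^ k = (1/2 :: real) ^ k"
      by (simp add: power_mult_distrib[symmetric])
    finally show ?thesis by (simp add: ennreal_leI)
  qed
  have "(\<integral>\<^sup>+\<omega>. (\<Sum>k. ennreal (2 ^ k * (D k \<omega>)\<^sup>2)) \<partial>M) = (\<Sum>k. \<integral>\<^sup>+\<omega>. ennreal (2 ^ k * (D k \<omega>)\<^sup>2) \<partial>M)"
    by (intro nn_integral_suminf) auto
  also have "\<dots> \<le> (\<Sum>k. ennreal ((1/2) ^ k))"
    by (intro suminf_le weighted) auto
  also have "\<dots> = ennreal (\<Sum>k. (1/2) ^ k)"
    by (intro suminf_ennreal2) auto
  finally have "(\<integral>\<^sup>+\<omega>. (\<Sum>k. ennreal (2 ^ k * (D k \<omega>)\<^sup>2)) \<partial>M) \<noteq> \<infinity>"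
    by (auto simp: top_unique)
  then have "AE \<omega> in M. (\<Sum>k. ennreal (2 ^ k * (D k \<omega>)\<^sup>2)) \<noteq> \<infinity>"
    by (intro nn_integral_PInf_AE) auto
  then show ?thesis
  proof eventually_elim
    case (elim \<omega>)
    then have "summable (\<lambda>k. 2 ^ k * (D k \<omega>)\<^sup>2)"
      by (intro summable_suminf_not_top) auto
    then have s: "summable (\<lambda>k. (1/2) ^ k + 2 ^ k * (D k \<omega>)\<^sup>2)"
      by (intro summable_add) (auto simp: summable_geometric)
    have "\<bar>x\<bar> \<le> (1/2) ^ k + 2 ^ k * x\<^sup>2" for x :: real and k
    proof (cases "\<bar>x\<bar> \<le> (1/2) ^ k")
      case True
      then show ?thesis by (simp add: add_increasing2)
    next
      case False
      then have "1 \<le> 2 ^ k * \<bar>x\<bar>" by (simp add: power_one_over field_simps)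
      then have "\<bar>x\<bar> * 1 \<le> \<bar>x\<bar> * (2 ^ k * \<bar>x\<bar>)" by (intro mult_left_mono) auto
      also have "\<dots> = 2 ^ k * x\<^sup>2" by (simp add: power2_eq_square)
      finally show ?thesis by (simp add: add_increasing)
    qed
    then show ?case by (intro summable_comparison_test[OF _ s]) auto
  qed
qed

text \<open>Completeness of \<open>L\<^sup>2\<close>: a rapidly convergent subsequence converges almost everywhere, and
  Fatou's lemma transfers the Cauchy bounds to its limit.\<close>

lemma L2_complete:
  fixes X :: "nat \<Rightarrow> 'a \<Rightarrow> real"
  assumes X: "\<And>n. in_Lp 2 M (X n)"
    and Cauchy: "\<And>\<epsilon>. 0 < \<epsilon> \<Longrightarrow> \<exists>N. \<forall>m\<ge>N. \<forall>n\<ge>N. (LINT \<omega>|M. (X m \<omega> - X n \<omega>)\<^sup>2) \<le> \<epsilon>"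
  shows "\<exists>Y. in_Lp 2 M Y \<and> (\<lambda>n. LINT \<omega>|M. (X n \<omega> - Y \<omega>)\<^sup>2) \<longlonglongrightarrow> 0"
proof -
  have [measurable]: "X n \<in> borel_measurable M" for n using X by (simp add: in_Lp_2_iff)
  have diff: "in_Lp 2 M (\<lambda>\<omega>. X m \<omega> - X n \<omega>)" for m n
    using X by (intro in_Lp_diff) auto
  have "\<forall>k::nat. \<exists>N. \<forall>m\<ge>N. \<forall>n\<ge>N. (LINT \<omega>|M. (X m \<omega> - X n \<omega>)\<^sup>2) \<le> (1/4) ^ k"
    by (intro allI Cauchy) simp
  then obtain N where N: "\<And>k m n. N k \<le> m \<Longrightarrow> N k \<le> n \<Longrightarrow> (LINT \<omega>|M. (X m \<omega> - X n \<omega>)\<^sup>2) \<le> (1/4) ^ k"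
    by metis
  define r where "r k = k + (\<Sum>i\<le>k. N i)" for k
  have r: "N k \<le> r k" "k \<le> r k" "N k \<le> r (Suc k)" for k
  proof -
    have "N k \<le> (\<Sum>i\<le>k. N i)" by (intro member_le_sum) auto
    then show "N k \<le> r k" "k \<le> r k" "N k \<le> r (Suc k)" by (auto simp: r_def)
  qed
  define Y where "Y \<omega> = lim (\<lambda>k. X (r k) \<omega>)" for \<omega>
  have Y[measurable]: "Y \<in> borel_measurable M"
    unfolding Y_def by measurable
  have "AE \<omega> in M. summable (\<lambda>k. \<bar>X (r (Suc k)) \<omega> - X (r k) \<omega>\<bar>)"
    using diff r by (intro AE_summable_of_second_moments N) auto
  then have lim: "AE \<omega> in M. (\<lambda>k. X (r k) \<omega>) \<longlonglongrightarrow> Y \<omega>"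
  proof eventually_elim
    case (elim \<omega>)
    then have "summable (\<lambda>k. X (r (Suc k)) \<omega> - X (r k) \<omega>)"
      by (rule summable_rabs_cancel)
    then have "convergent (\<lambda>n. \<Sum>k<n. X (r (Suc k)) \<omega> - X (r k) \<omega>)"
      by (simp add: summable_iff_convergent)
    then have "convergent (\<lambda>n. (X (r n) \<omega> - X (r 0) \<omega>) + X (r 0) \<omega>)"
      by (intro convergent_add convergent_const)
        (simp only: sum_lessThan_telescope[of "\<lambda>k. X (r k) \<omega>"])
    then show ?case by (simp add: Y_def convergent_LIMSEQ_iff)
  qed
  have fatou: "(\<integral>\<^sup>+\<omega>. ennreal ((X n \<omega> - Y \<omega>)\<^sup>2) \<partial>M) \<le> ennreal \<epsilon>"
    if "0 \<le> \<epsilon>" "\<forall>m\<ge>N. (LINT \<omega>|M. (X n \<omega> - X m \<omega>)\<^sup>2) \<le> \<epsilon>" for n N \<epsilon>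
  proof -
    have "(\<integral>\<^sup>+\<omega>. ennreal ((X n \<omega> - Y \<omega>)\<^sup>2) \<partial>M) =
        (\<integral>\<^sup>+\<omega>. liminf (\<lambda>k. ennreal ((X n \<omega> - X (r k) \<omega>)\<^sup>2)) \<partial>M)"
    proof (rule nn_integral_cong_AE)
      show "AE \<omega> in M. ennreal ((X n \<omega> - Y \<omega>)\<^sup>2) = liminf (\<lambda>k. ennreal ((X n \<omega> - X (r k) \<omega>)\<^sup>2))"
        using lim
      proof eventually_elim
        case (elim \<omega>)
        have "(\<lambda>k. ennreal ((X n \<omega> - X (r k) \<omega>)\<^sup>2)) \<longlonglongrightarrow> ennreal ((X n \<omega> - Y \<omega>)\<^sup>2)"
          by (intro tendsto_ennrealI tendsto_intros elim)
        then show ?case by (intro lim_imp_Liminf[symmetric]) auto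
      qed
    qed
    also have "\<dots> \<le> liminf (\<lambda>k. \<integral>\<^sup>+\<omega>. ennreal ((X n \<omega> - X (r k) \<omega>)\<^sup>2) \<partial>M)"
      by (intro nn_integral_liminf) auto
    also have "\<dots> \<le> limsup (\<lambda>k. \<integral>\<^sup>+\<omega>. ennreal ((X n \<omega> - X (r k) \<omega>)\<^sup>2) \<partial>M)"
      by (intro Liminf_le_Limsup) auto
    also have "\<dots> \<le> ennreal \<epsilon>"
    proof (rule Limsup_bounded)
      show "\<forall>\<^sub>F k in sequentially. (\<integral>\<^sup>+\<omega>. ennreal ((X n \<omega> - X (r k) \<omega>)\<^sup>2) \<partial>M) \<le> ennreal \<epsilon>"
        using eventually_ge_at_top[of N]
      proof eventually_elim
        case (elim k)
        have "(\<integral>\<^sup>+\<omega>. ennreal ((X n \<omega> - X (r k) \<omega>)\<^sup>2) \<partial>M) = ennreal (LINT \<omega>|M. (X n \<omega> - X (r k) \<omega>)\<^sup>2)"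
          using diff by (intro nn_integral_eq_integral) (auto simp: in_Lp_2_iff)
        also have "\<dots> \<le> ennreal \<epsilon>"
          using that elim r(2)[of k] by (intro ennreal_leI) auto
        finally show ?case .
      qed
    qed
    finally show ?thesis .
  qed
  have diffY: "in_Lp 2 M (\<lambda>\<omega>. X n \<omega> - Y \<omega>)" if "N 0 \<le> n" for n
  proof -
    have "(\<integral>\<^sup>+\<omega>. ennreal ((X n \<omega> - Y \<omega>)\<^sup>2) \<partial>M) \<le> ennreal 1"
      using N[of 0 n] that by (intro fatou[of 1 "N 0"]) auto
    also have "\<dots> < \<infinity>" by simp
    finally show ?thesis
      unfolding in_Lp_2_iff by (auto intro!: integrableI_bounded)
  qed
  have "in_Lp 2 M (\<lambda>\<omega>. X (N 0) \<omega> - (X (N 0) \<omega> - Y \<omega>))"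
    by (intro in_Lp_diff X diffY) auto
  then have YL: "in_Lp 2 M Y" by simp
  have "(\<lambda>n. LINT \<omega>|M. (X n \<omega> - Y \<omega>)\<^sup>2) \<longlonglongrightarrow> 0"
  proof (rule LIMSEQ_I)
    fix e :: real assume e: "0 < e"
    then obtain N' where N': "\<forall>m\<ge>N'. \<forall>n\<ge>N'. (LINT \<omega>|M. (X m \<omega> - X n \<omega>)\<^sup>2) \<le> e / 2"
      using Cauchy[of "e / 2"] by auto
    have "norm ((LINT \<omega>|M. (X n \<omega> - Y \<omega>)\<^sup>2) - 0) < e" if "N' \<le> n" for n
    proof -
      have "ennreal (LINT \<omega>|M. (X n \<omega> - Y \<omega>)\<^sup>2) = (\<integral>\<^sup>+\<omega>. ennreal ((X n \<omega> - Y \<omega>)\<^sup>2) \<partial>M)"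
        using in_Lp_diff[OF _ X YL, of n]
        by (intro nn_integral_eq_integral[symmetric]) (auto simp: in_Lp_2_iff)
      also have "\<dots> \<le> ennreal (e / 2)"
        using N' that e by (intro fatou[of _ N']) auto
      finally have "(LINT \<omega>|M. (X n \<omega> - Y \<omega>)\<^sup>2) \<le> e / 2"
        using e by (simp add: ennreal_le_iff)
      then show ?thesis using e by simp
    qed
    then show "\<exists>N'. \<forall>n\<ge>N'. norm ((LINT \<omega>|M. (X n \<omega> - Y \<omega>)\<^sup>2) - 0) < e" by blast
  qed
  with YL show ?thesis by blast
qed

section \<open>Extension by continuity\<close>

lemma mult_powr_small:
  fixes A s \<epsilon> :: real
  assumes "0 \<le> A" "0 < s" "0 < \<epsilon>"
  shows "\<exists>\<delta>>0. \<forall>x. 0 \<le> x \<and> x \<le> \<delta> \<longrightarrow> A * x powr s \<le> \<epsilon>"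
proof (intro exI conjI allI impI)
  define \<delta> where "\<delta> = (\<epsilon> / (A + 1)) powr (1 / s)"
  show "0 < \<delta>" using assms by (simp add: \<delta>_def)
  fix x assume x: "0 \<le> x \<and> x \<le> \<delta>"
  then have "x powr s \<le> \<delta> powr s" using assms by (intro powr_mono2) auto
  also have "\<dots> = \<epsilon> / (A + 1)" using assms by (simp add: \<delta>_def powr_powr)
  finally have "A * x powr s \<le> A * (\<epsilon> / (A + 1))" using assms by (intro mult_left_mono) auto
  also have "\<dots> \<le> \<epsilon>" using assms by (simp add: field_simps)
  finally show "A * x powr s \<le> \<epsilon>" .
qed

lemma elementary_integral_in_Lp:
  assumes "elementary_integral \<xi> g X" "0 < q"
  shows "in_Lp q lebesgue g"
proof -
  from assms obtain n :: nat and a b c where ab: "\<And>i. i < n \<Longrightarrow> 0 \<le> a i \<and> a i \<le> b i"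
    and g: "g = (\<lambda>x. \<Sum>i<n. c i * indicator {a i..<b i} x)"
    unfolding elementary_integral_def by blast
  have meas: "g \<in> borel_measurable borel"
    using assms(1) by (rule elementary_integral_measurable)
  define C where "C = (\<Sum>i<n. \<bar>c i\<bar>)"
  define B where "B = Max (insert 0 (b ` {..<n}))"
  have B: "b i \<le> B" if "i < n" for i using that by (auto simp: B_def)
  have bound: "\<bar>g x\<bar> powr q \<le> C powr q * indicator {0..B} x" for x
    unfolding g C_def using assms(2) ab B by (intro step_function_powr_le) auto
  have "integrable lborel (\<lambda>x. \<bar>g x\<bar> powr q)"
  proof (rule Bochner_Integration.integrable_bound)
    show "integrable lborel (\<lambda>x. C powr q * indicator {0..B} x)"
      by (intro integrable_mult_right integrable_real_indicator) (auto simp: emeasure_lborel_Icc_eq)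
    show "AE x in lborel. norm (\<bar>g x\<bar> powr q) \<le> norm (C powr q * indicator {0..B} x :: real)"
      using bound by (auto simp: abs_mult)
  qed (use meas in auto)
  then have "integrable lebesgue (\<lambda>x. \<bar>g x\<bar> powr q)"
    using meas by (subst integrable_completion) auto
  then show ?thesis
    using meas by (auto simp: in_Lp_def intro: measurable_completion)
qed

context fbm
begin

abbreviation Lp_dist :: "(real \<Rightarrow> real) \<Rightarrow> (real \<Rightarrow> real) \<Rightarrow> real" where
  "Lp_dist g h \<equiv> LINT x|lebesgue. \<bar>g x - h x\<bar> powr p"

lemma Lp_dist_nonneg: "0 \<le> Lp_dist g h"
  by simp

lemma elementary_in_L2: "elementary_integral \<xi> g X \<Longrightarrow> in_Lp 2 M X"
  using elementary_integral_square_integrable by (simp add: in_Lp_2_iff)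

lemma elementary_integral_dist:
  assumes "elementary_integral \<xi> g X" "elementary_integral \<xi> h Y"
  shows "expectation (\<lambda>\<omega>. (X \<omega> - Y \<omega>)\<^sup>2) \<le> K * Lp_dist g h powr (1 + \<alpha>)"
proof -
  have "g \<in> borel_measurable borel" "h \<in> borel_measurable borel"
    using assms elementary_integral_measurable by auto
  then have "Lp_dist g h = (LINT x|lborel. \<bar>g x - h x\<bar> powr p)"
    by (intro integral_completion) simp
  then show ?thesis
    using elementary_integral_bound[OF elementary_integral_diff[OF assms]] by simp
qed

text \<open>The integral of \<open>G\<close> is characterised by its distance to all elementary integrals. The
  constant 8 pays for one triangle inequality in \<open>L\<^sup>2\<close> and one in the \<open>p\<close>-th mean.\<close>

definition wiener_integral :: "(real \<Rightarrow> real) \<Rightarrow> ('a \<Rightarrow> real) \<Rightarrow> bool" where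
  "wiener_integral G Y \<longleftrightarrow> in_Lp 2 M Y \<and>
     (\<forall>g X. elementary_integral \<xi> g X \<longrightarrow>
        expectation (\<lambda>\<omega>. (X \<omega> - Y \<omega>)\<^sup>2) \<le> 8 * K * Lp_dist g G powr (1 + \<alpha>))"

definition elementary_approximation ::
    "(real \<Rightarrow> real) \<Rightarrow> (nat \<Rightarrow> real \<Rightarrow> real) \<Rightarrow> (nat \<Rightarrow> 'a \<Rightarrow> real) \<Rightarrow> bool" where
  "elementary_approximation G g X \<longleftrightarrow>
     (\<forall>n. elementary_integral \<xi> (g n) (X n)) \<and> (\<lambda>n. Lp_dist (g n) G) \<longlonglongrightarrow> 0"

lemma quasi_norm_constant: "(2 powr p * x) powr (1 + \<alpha>) = 4 * x powr (1 + \<alpha>)"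
  using p_mult by (simp add: powr_mult powr_powr)

lemma tendsto_powr_exponent:
  assumes "a \<longlonglongrightarrow> l" "\<And>n. 0 \<le> a n"
  shows "(\<lambda>n. a n powr (1 + \<alpha>)) \<longlonglongrightarrow> l powr (1 + \<alpha>)"
  using assms \<alpha>_pos by (intro tendsto_powr' tendsto_const) (auto intro: always_eventually)

text \<open>The fundamental estimate turns the approximating step functions, Cauchy in the \<open>p\<close>-th
  mean, into a Cauchy sequence in \<open>L\<^sup>2\<close>; comparing with its members carries the estimate over
  to the limit.\<close>

lemma wiener_integral_exists:
  assumes G: "in_Lp p lebesgue G" and gX: "elementary_approximation G g X"
  shows "\<exists>Y. wiener_integral G Y"
proof -
  let ?a = "\<lambda>n. Lp_dist (g n) G"
  have el: "elementary_integral \<xi> (g n) (X n)" and a0: "?a \<longlonglongrightarrow> 0" for n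
    using gX by (auto simp: elementary_approximation_def)
  have gL: "in_Lp p lebesgue (g n)" for n
    using el elementary_integral_in_Lp p_pos by blast
  have dist: "Lp_dist (g m) h \<le> 2 powr p * (?a m + Lp_dist h G)" if "in_Lp p lebesgue h" for m h
    using integral_abs_diff_powr_triangle[OF p_pos gL[of m] G that]
    by (simp add: abs_minus_commute)
  have "\<exists>Y. in_Lp 2 M Y \<and> (\<lambda>n. expectation (\<lambda>\<omega>. (X n \<omega> - Y \<omega>)\<^sup>2)) \<longlonglongrightarrow> 0"
  proof (rule L2_complete)
    show "in_Lp 2 M (X n)" for n using el by (rule elementary_in_L2)
    fix \<epsilon> :: real assume "0 < \<epsilon>"
    then obtain \<delta> where \<delta>: "0 < \<delta>" "\<And>x. 0 \<le> x \<Longrightarrow> x \<le> \<delta> \<Longrightarrow> (K * 4) * x powr (1 + \<alpha>) \<le> \<epsilon>"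
      using mult_powr_small[of "K * 4" "1 + \<alpha>" \<epsilon>] K_nonneg \<alpha>_pos by auto
    from order_tendstoD(2)[OF a0, of "\<delta> / 2"] \<delta>(1) obtain N where N: "\<And>n. N \<le> n \<Longrightarrow> ?a n < \<delta> / 2"
      by (auto simp: eventually_sequentially)
    have "expectation (\<lambda>\<omega>. (X m \<omega> - X n \<omega>)\<^sup>2) \<le> \<epsilon>" if "N \<le> m" "N \<le> n" for m n
    proof -
      have "expectation (\<lambda>\<omega>. (X m \<omega> - X n \<omega>)\<^sup>2) \<le> K * Lp_dist (g m) (g n) powr (1 + \<alpha>)"
        by (intro elementary_integral_dist el)
      also have "\<dots> \<le> K * (2 powr p * (?a m + ?a n)) powr (1 + \<alpha>)"
        using \<alpha>_pos K_nonneg by (intro mult_left_mono powr_mono2 dist gL) auto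
      also have "\<dots> = (K * 4) * (?a m + ?a n) powr (1 + \<alpha>)"
        by (simp only: quasi_norm_constant mult.assoc)
      also have "\<dots> \<le> \<epsilon>"
        using N[OF that(1)] N[OF that(2)] by (intro \<delta>(2)) (auto intro: add_nonneg_nonneg Lp_dist_nonneg)
      finally show ?thesis .
    qed
    then show "\<exists>N. \<forall>m\<ge>N. \<forall>n\<ge>N. expectation (\<lambda>\<omega>. (X m \<omega> - X n \<omega>)\<^sup>2) \<le> \<epsilon>" by blast
  qed
  then obtain Y where Y: "in_Lp 2 M Y" and lim: "(\<lambda>n. expectation (\<lambda>\<omega>. (X n \<omega> - Y \<omega>)\<^sup>2)) \<longlonglongrightarrow> 0"
    by blast
  have "expectation (\<lambda>\<omega>. (Z \<omega> - Y \<omega>)\<^sup>2) \<le> 8 * K * Lp_dist h G powr (1 + \<alpha>)"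
    if h: "elementary_integral \<xi> h Z" for h Z
  proof (rule LIMSEQ_le_const)
    have hL: "in_Lp p lebesgue h" using h p_pos by (rule elementary_integral_in_Lp)
    have "(\<lambda>n. 2 * (K * (4 * (?a n + Lp_dist h G) powr (1 + \<alpha>))) + 2 * expectation (\<lambda>\<omega>. (X n \<omega> - Y \<omega>)\<^sup>2))
        \<longlonglongrightarrow> 2 * (K * (4 * (0 + Lp_dist h G) powr (1 + \<alpha>))) + 2 * 0"
      by (intro tendsto_add tendsto_mult tendsto_const tendsto_powr_exponent lim a0)
        (auto intro: add_nonneg_nonneg)
    then show "(\<lambda>n. 2 * (K * (4 * (?a n + Lp_dist h G) powr (1 + \<alpha>))) + 2 * expectation (\<lambda>\<omega>. (X n \<omega> - Y \<omega>)\<^sup>2))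
        \<longlonglongrightarrow> 8 * K * Lp_dist h G powr (1 + \<alpha>)"
      by (simp add: mult.assoc)
    have "expectation (\<lambda>\<omega>. (Z \<omega> - Y \<omega>)\<^sup>2) \<le>
        2 * (K * (4 * (?a n + Lp_dist h G) powr (1 + \<alpha>))) + 2 * expectation (\<lambda>\<omega>. (X n \<omega> - Y \<omega>)\<^sup>2)" for n
    proof -
      have "expectation (\<lambda>\<omega>. (Z \<omega> - Y \<omega>)\<^sup>2) \<le>
          2 * expectation (\<lambda>\<omega>. (X n \<omega> - Z \<omega>)\<^sup>2) + 2 * expectation (\<lambda>\<omega>. (X n \<omega> - Y \<omega>)\<^sup>2)"
        by (intro square_triangle elementary_in_L2[OF el] elementary_in_L2[OF h] Y)
      also have "expectation (\<lambda>\<omega>. (X n \<omega> - Z \<omega>)\<^sup>2) \<le> K * Lp_dist (g n) h powr (1 + \<alpha>)"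
        by (intro elementary_integral_dist el h)
      also have "\<dots> \<le> K * (2 powr p * (?a n + Lp_dist h G)) powr (1 + \<alpha>)"
        using \<alpha>_pos K_nonneg by (intro mult_left_mono powr_mono2 dist hL) auto
      finally show ?thesis by (simp only: quasi_norm_constant)
    qed
    then show "\<exists>N. \<forall>n\<ge>N. expectation (\<lambda>\<omega>. (Z \<omega> - Y \<omega>)\<^sup>2) \<le>
        2 * (K * (4 * (?a n + Lp_dist h G) powr (1 + \<alpha>))) + 2 * expectation (\<lambda>\<omega>. (X n \<omega> - Y \<omega>)\<^sup>2)"
      by blast
  qed
  with Y show ?thesis by (auto simp: wiener_integral_def)
qed

text \<open>The characterisation mentions no particular sequence; hence the limit is the same along
  every approximating sequence.\<close>

lemma wiener_integral_limit:
  assumes Y: "wiener_integral G Y" and gX: "elementary_approximation G g X"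
  shows "(\<lambda>n. expectation (\<lambda>\<omega>. (X n \<omega> - Y \<omega>)\<^sup>2)) \<longlonglongrightarrow> 0"
proof (rule tendsto_sandwich[OF _ _ tendsto_const])
  have "(\<lambda>n. 8 * K * Lp_dist (g n) G powr (1 + \<alpha>)) \<longlonglongrightarrow> 8 * K * 0 powr (1 + \<alpha>)"
    using gX by (intro tendsto_mult tendsto_const tendsto_powr_exponent)
      (auto simp: elementary_approximation_def)
  then show "(\<lambda>n. 8 * K * Lp_dist (g n) G powr (1 + \<alpha>)) \<longlonglongrightarrow> 0" by simp
  show "\<forall>\<^sub>F n in sequentially. expectation (\<lambda>\<omega>. (X n \<omega> - Y \<omega>)\<^sup>2) \<le> 8 * K * Lp_dist (g n) G powr (1 + \<alpha>)"
    using Y gX by (auto simp: wiener_integral_def elementary_approximation_def)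
qed auto

lemma wiener_integral_second_moment:
  assumes "wiener_integral G Y"
  shows "expectation (\<lambda>\<omega>. (Y \<omega>)\<^sup>2) \<le> 8 * K * (LINT x|lebesgue. \<bar>G x\<bar> powr p) powr (1 + \<alpha>)"
proof -
  have "expectation (\<lambda>\<omega>. (0 - Y \<omega>)\<^sup>2) \<le> 8 * K * Lp_dist (\<lambda>_. 0) G powr (1 + \<alpha>)"
    using assms elementary_integral_zero unfolding wiener_integral_def by blast
  then show ?thesis by simp
qed

lemma wiener_integral_dist:
  assumes Y: "wiener_integral G Y" and Z: "wiener_integral H Z"
    and G: "in_Lp p lebesgue G" and H: "in_Lp p lebesgue H"
    and gX: "elementary_approximation G g X"
  shows "expectation (\<lambda>\<omega>. (Y \<omega> - Z \<omega>)\<^sup>2) \<le> 64 * K * Lp_dist G H powr (1 + \<alpha>)"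
proof (rule LIMSEQ_le_const)
  let ?a = "\<lambda>n. Lp_dist (g n) G"
  have el: "elementary_integral \<xi> (g n) (X n)" and a0: "?a \<longlonglongrightarrow> 0" for n
    using gX by (auto simp: elementary_approximation_def)
  have "(\<lambda>n. 2 * expectation (\<lambda>\<omega>. (X n \<omega> - Y \<omega>)\<^sup>2) + 2 * (8 * K * (4 * (?a n + Lp_dist G H) powr (1 + \<alpha>))))
      \<longlonglongrightarrow> 2 * 0 + 2 * (8 * K * (4 * (0 + Lp_dist G H) powr (1 + \<alpha>)))"
    by (intro tendsto_add tendsto_mult tendsto_const tendsto_powr_exponent a0
        wiener_integral_limit[OF Y gX]) (auto intro: add_nonneg_nonneg)
  then show "(\<lambda>n. 2 * expectation (\<lambda>\<omega>. (X n \<omega> - Y \<omega>)\<^sup>2) + 2 * (8 * K * (4 * (?a n + Lp_dist G H) powr (1 + \<alpha>))))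
      \<longlonglongrightarrow> 64 * K * Lp_dist G H powr (1 + \<alpha>)"
    by (simp add: mult.assoc)
  have "expectation (\<lambda>\<omega>. (Y \<omega> - Z \<omega>)\<^sup>2) \<le>
      2 * expectation (\<lambda>\<omega>. (X n \<omega> - Y \<omega>)\<^sup>2) + 2 * (8 * K * (4 * (?a n + Lp_dist G H) powr (1 + \<alpha>)))" for n
  proof -
    have gL: "in_Lp p lebesgue (g n)"
      using el p_pos by (rule elementary_integral_in_Lp)
    have "expectation (\<lambda>\<omega>. (Y \<omega> - Z \<omega>)\<^sup>2) \<le>
        2 * expectation (\<lambda>\<omega>. (X n \<omega> - Y \<omega>)\<^sup>2) + 2 * expectation (\<lambda>\<omega>. (X n \<omega> - Z \<omega>)\<^sup>2)"
      using Y Z by (intro square_triangle elementary_in_L2[OF el]) (auto simp: wiener_integral_def)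
    also have "expectation (\<lambda>\<omega>. (X n \<omega> - Z \<omega>)\<^sup>2) \<le> 8 * K * Lp_dist (g n) H powr (1 + \<alpha>)"
      using Z el unfolding wiener_integral_def by blast
    also have "\<dots> \<le> 8 * K * (2 powr p * (?a n + Lp_dist G H)) powr (1 + \<alpha>)"
      using integral_abs_diff_powr_triangle[OF p_pos gL G H] K_nonneg \<alpha>_pos
      by (intro mult_left_mono powr_mono2) (auto simp: abs_minus_commute)
    finally show ?thesis by (simp only: quasi_norm_constant)
  qed
  then show "\<exists>N. \<forall>n\<ge>N. expectation (\<lambda>\<omega>. (Y \<omega> - Z \<omega>)\<^sup>2) \<le>
      2 * expectation (\<lambda>\<omega>. (X n \<omega> - Y \<omega>)\<^sup>2) + 2 * (8 * K * (4 * (?a n + Lp_dist G H) powr (1 + \<alpha>)))"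
    by blast
qed

end

section \<open>Approximation by dyadic step functions\<close>

lemma in_Lp_restrict_iff:
  assumes "S \<in> sets lebesgue" "0 < q"
  shows "in_Lp q (lebesgue_on S) f \<longleftrightarrow> in_Lp q lebesgue (\<lambda>x. indicator S x * f x)"
proof -
  have "(\<lambda>x. \<bar>indicator S x * f x\<bar> powr q) = (\<lambda>x. indicator S x *\<^sub>R \<bar>f x\<bar> powr q)"
    by (intro ext) (simp split: split_indicator)
  then show ?thesis
    using assms by (simp add: in_Lp_def borel_measurable_restrict_space_iff integrable_restrict_space)
qed

lemma integral_abs_powr_restrict:
  fixes f :: "'a::euclidean_space \<Rightarrow> real"
  assumes "S \<in> sets lebesgue" "0 < q"
  shows "(LINT x|lebesgue_on S. \<bar>f x\<bar> powr q) = (LINT x|lebesgue. \<bar>indicator S x * f x\<bar> powr q)"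
proof -
  have "(\<lambda>x. \<bar>indicator S x * f x\<bar> powr q) = (\<lambda>x. indicator S x *\<^sub>R \<bar>f x\<bar> powr q)"
    by (intro ext) (simp split: split_indicator)
  then show ?thesis
    using assms by (simp add: integral_restrict_space)
qed

lemma bounded_convergence_Lp:
  fixes h :: "nat \<Rightarrow> 'a \<Rightarrow> real"
  assumes "finite_measure N" and q: "0 < q"
    and h: "\<And>n. h n \<in> borel_measurable N" and l: "l \<in> borel_measurable N"
    and bound: "\<And>n x. \<bar>h n x\<bar> \<le> C" and lim: "AE x in N. (\<lambda>n. h n x) \<longlonglongrightarrow> l x"
  shows "\<And>n. in_Lp q N (h n)" and "(\<lambda>n. LINT x|N. \<bar>h n x - l x\<bar> powr q) \<longlonglongrightarrow> 0"
proof -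
  interpret finite_measure N by fact
  note [measurable] = h l
  have C: "0 \<le> C" using bound[of 0 undefined] by linarith
  show "in_Lp q N (h n)" for n
    unfolding in_Lp_def
  proof
    show "integrable N (\<lambda>x. \<bar>h n x\<bar> powr q)"
      using bound q by (intro integrable_const_bound[of _ "C powr q"]) (auto intro!: powr_mono2)
  qed simp
  have "(\<lambda>n. LINT x|N. \<bar>h n x - l x\<bar> powr q) \<longlonglongrightarrow> (LINT x|N. 0)"
  proof (rule integral_dominated_convergence)
    show "AE x in N. (\<lambda>n. \<bar>h n x - l x\<bar> powr q) \<longlonglongrightarrow> 0"
      using lim
    proof eventually_elim
      case (elim x)
      then have "(\<lambda>n. h n x - l x) \<longlonglongrightarrow> 0" by (simp add: LIM_zero_iff)
      from tendsto_abs_powr[OF this q] show ?case using q by simp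
    qed
    show "AE x in N. norm (\<bar>h n x - l x\<bar> powr q) \<le> (2 * C) powr q" for n
      using lim
    proof eventually_elim
      case (elim x)
      then have "\<bar>l x\<bar> \<le> C"
        using bound by (intro LIMSEQ_le_const2[OF tendsto_rabs[OF elim]]) auto
      then have "\<bar>h n x - l x\<bar> \<le> 2 * C" using bound[of n x] by linarith
      then show ?case using q by (auto intro: powr_mono2)
    qed
  qed (use C in auto)
  then show "(\<lambda>n. LINT x|N. \<bar>h n x - l x\<bar> powr q) \<longlonglongrightarrow> 0" by simp
qed

definition clamp_abs :: "real \<Rightarrow> real \<Rightarrow> real" where
  "clamp_abs k y = max (- k) (min k y)"

lemma abs_clamp_abs_le: "0 \<le> k \<Longrightarrow> \<bar>clamp_abs k y\<bar> \<le> k"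
  by (auto simp: clamp_abs_def)

lemma continuous_clamp_abs: "continuous_on UNIV (clamp_abs k)"
  unfolding clamp_abs_def by (intro continuous_intros)

lemma clamp_abs_eq: "\<bar>y\<bar> \<le> k \<Longrightarrow> clamp_abs k y = y"
  by (auto simp: clamp_abs_def)

lemma clamp_abs_diff_le: "0 \<le> k \<Longrightarrow> \<bar>clamp_abs k y - y\<bar> \<le> \<bar>y\<bar>"
  by (auto simp: clamp_abs_def)

lemma truncation_tendsto_Lp:
  fixes f :: "'a \<Rightarrow> real"
  assumes q: "0 < q" and f: "in_Lp q N f"
  shows "(\<lambda>k. LINT x|N. \<bar>clamp_abs (real k) (f x) - f x\<bar> powr q) \<longlonglongrightarrow> 0"
proof -
  have [measurable]: "f \<in> borel_measurable N" using f by (simp add: in_Lp_def)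
  have "(\<lambda>k. LINT x|N. \<bar>clamp_abs (real k) (f x) - f x\<bar> powr q) \<longlonglongrightarrow> (LINT x|N. 0)"
  proof (rule integral_dominated_convergence)
    show "integrable N (\<lambda>x. \<bar>f x\<bar> powr q)" using f by (simp add: in_Lp_def)
    show "AE x in N. (\<lambda>k. \<bar>clamp_abs (real k) (f x) - f x\<bar> powr q) \<longlonglongrightarrow> 0"
    proof (rule AE_I2)
      fix x
      obtain k0 :: nat where "\<bar>f x\<bar> \<le> real k0" using real_arch_simple by blast
      then have "clamp_abs (real k) (f x) = f x" if "k0 \<le> k" for k
        using that by (intro clamp_abs_eq) linarith
      then show "(\<lambda>k. \<bar>clamp_abs (real k) (f x) - f x\<bar> powr q) \<longlonglongrightarrow> 0"
        using q by (intro tendsto_eventually) (auto simp: eventually_sequentially)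
    qed
    show "AE x in N. norm (\<bar>clamp_abs (real k) (f x) - f x\<bar> powr q) \<le> \<bar>f x\<bar> powr q" for k
      using q clamp_abs_diff_le[of "real k"] by (auto intro!: powr_mono2)
  qed (auto simp: clamp_abs_def)
  then show ?thesis by simp
qed

lemma dyadic_point_eq: "dyadic_point t n i = real i * (t / 2 ^ n)"
  by (simp add: dyadic_point_def)

lemma dyadic_simple_sample:
  assumes "0 \<le> t"
  shows "dyadic_simple t n (\<lambda>\<tau>. g (round_down (t / 2 ^ n) \<tau>))"
  unfolding dyadic_simple_def
proof
  fix \<tau> assume \<tau>: "\<tau> \<in> {0..<t}"
  define h where "h = t / 2 ^ n"
  have h: "0 < h" using \<tau> by (auto simp: h_def)
  define r where "r = nat \<lfloor>\<tau> / h\<rfloor>"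
  have iff: "real m * h \<le> \<tau> \<longleftrightarrow> m \<le> r" for m
    unfolding r_def using \<tau> by (intro multiple_le_iff h) auto
  have ind: "indicator {real i * h..<real (Suc i) * h} \<tau> = (if i = r then 1 else 0 :: real)" for i
    using iff[of i] iff[of "Suc i"] by (auto simp: indicator_def not_le[symmetric] simp del: of_nat_Suc)
  have "real (2 ^ n) * h = t" by (simp add: h_def)
  then have "r < 2 ^ n" using iff[of "2 ^ n"] \<tau> by (auto simp: not_le[symmetric])
  moreover have "round_down h (real i * h) = real i * h" for i
    using h by (simp add: round_down_def)
  ultimately show "g (round_down (t / 2 ^ n) \<tau>) =
      (\<Sum>i<2 ^ n. g (round_down (t / 2 ^ n) (dyadic_point t n i)) *
        indicator {dyadic_point t n i..<dyadic_point t n (Suc i)} \<tau>)"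
    unfolding dyadic_point_eq h_def[symmetric] ind
    by (simp add: if_distrib[of "\<lambda>z. _ * z"] r_def[symmetric] round_down_def[of h \<tau>] cong: if_cong)
qed

lemma round_down_dyadic_tendsto:
  assumes "x \<in> {0..t}"
  shows "(\<lambda>n. round_down (t / 2 ^ n) x) \<longlonglongrightarrow> x"
proof (cases "t = 0")
  case True
  \<comment> \<open>division by zero makes the rounded value 0, which is the only point of the interval\<close>
  then show ?thesis using assms by (simp add: round_down_def)
next
  case False
  then have h: "0 < t / 2 ^ n" for n using assms by auto
  have x: "0 \<le> x" using assms by simp
  show ?thesis
  proof (rule tendsto_sandwich[OF _ _ _ tendsto_const])
    show "\<forall>\<^sub>F n in sequentially. x - t * (1/2) ^ n \<le> round_down (t / 2 ^ n) x"
      using round_down_bounds(2)[OF h x] by (intro always_eventually allI less_imp_le) (simp add: power_one_over)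
    show "\<forall>\<^sub>F n in sequentially. round_down (t / 2 ^ n) x \<le> x"
      using round_down_bounds(1)[OF h x] by (intro always_eventually allI)
    have "(\<lambda>n. x - t * (1/2) ^ n) \<longlonglongrightarrow> x - t * 0"
      by (intro tendsto_intros LIMSEQ_power_zero) simp
    then show "(\<lambda>n. x - t * (1/2) ^ n) \<longlonglongrightarrow> x" by simp
  qed
qed

lemma round_down_measurable: "round_down h \<in> borel_measurable borel"
  unfolding round_down_def by measurable

text \<open>A function in \<open>L\<^sup>q\<close> is truncated, the truncation is the almost everywhere limit of
  uniformly bounded continuous functions, and a bounded continuous function is the pointwise
  limit of its samples at dyadic points. Each limit also holds in the \<open>q\<close>-th mean.\<close>

lemma dyadic_simple_dense:
  assumes t: "0 \<le> t" and q: "0 < q" and f: "in_Lp q (lebesgue_on {0..t}) f" and \<epsilon>: "0 < \<epsilon>"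
  shows "\<exists>n \<phi>. dyadic_simple t n \<phi> \<and> in_Lp q (lebesgue_on {0..t}) \<phi> \<and>
           (LINT x|lebesgue_on {0..t}. \<bar>\<phi> x - f x\<bar> powr q) \<le> \<epsilon>"
proof -
  let ?N = "lebesgue_on {0..t}"
  have fin: "finite_measure ?N"
    by (rule finite_measureI) (simp add: space_restrict_space emeasure_restrict_space emeasure_lborel_Icc_eq)
  define approx where "approx f \<longleftrightarrow> (\<forall>\<epsilon>>0. \<exists>n \<phi>. dyadic_simple t n \<phi> \<and> in_Lp q ?N \<phi> \<and>
      (LINT x|?N. \<bar>\<phi> x - f x\<bar> powr q) \<le> \<epsilon>)" for f
  \<comment> \<open>approximability is closed under limits in the \<open>q\<close>-th mean\<close>
  have closed: "approx f"
    if h: "\<And>n. in_Lp q ?N (h n)" "\<And>n. approx (h n)" and f: "in_Lp q ?N f"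
      and lim: "(\<lambda>n. LINT x|?N. \<bar>h n x - f x\<bar> powr q) \<longlonglongrightarrow> 0" for h :: "nat \<Rightarrow> real \<Rightarrow> real" and f
    unfolding approx_def
  proof (intro allI impI)
    fix \<epsilon> :: real assume \<epsilon>: "0 < \<epsilon>"
    define \<delta> where "\<delta> = \<epsilon> / 2 powr q / 2"
    have \<delta>: "0 < \<delta>" using \<epsilon> by (simp add: \<delta>_def)
    from order_tendstoD(2)[OF lim \<delta>] obtain k where k: "(LINT x|?N. \<bar>h k x - f x\<bar> powr q) < \<delta>"
      by (auto simp: eventually_sequentially)
    from h(2)[of k] \<delta> obtain n \<phi> where \<phi>: "dyadic_simple t n \<phi>" "in_Lp q ?N \<phi>"
      "(LINT x|?N. \<bar>\<phi> x - h k x\<bar> powr q) \<le> \<delta>"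
      unfolding approx_def by blast
    have "(LINT x|?N. \<bar>\<phi> x - f x\<bar> powr q) \<le>
        2 powr q * ((LINT x|?N. \<bar>h k x - \<phi> x\<bar> powr q) + (LINT x|?N. \<bar>h k x - f x\<bar> powr q))"
      by (rule integral_abs_diff_powr_triangle[OF q \<phi>(2) h(1) f])
    also have "\<dots> \<le> 2 powr q * (\<delta> + \<delta>)"
      using \<phi>(3) k by (intro mult_left_mono add_mono) (auto simp: abs_minus_commute)
    also have "\<dots> = \<epsilon>" by (simp add: \<delta>_def)
    finally show "\<exists>n \<phi>. dyadic_simple t n \<phi> \<and> in_Lp q ?N \<phi> \<and>
        (LINT x|?N. \<bar>\<phi> x - f x\<bar> powr q) \<le> \<epsilon>"
      using \<phi> by blast
  qed
  have continuous: "approx g" if g: "continuous_on UNIV g" and C: "\<And>x. \<bar>g x\<bar> \<le> C" for g :: "real \<Rightarrow> real" and C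
    unfolding approx_def
  proof (intro allI impI)
    fix \<epsilon> :: real assume \<epsilon>: "0 < \<epsilon>"
    have gm: "g \<in> borel_measurable borel" using g by (rule borel_measurable_continuous_onI)
    let ?s = "\<lambda>n x. g (round_down (t / 2 ^ n) x)"
    have "?s n \<in> borel_measurable borel" for n
      using measurable_compose[OF round_down_measurable gm] .
    then have sm: "?s n \<in> borel_measurable ?N" "g \<in> borel_measurable ?N" for n
      using gm by (auto intro!: measurable_restrict_space1 measurable_completion)
    have lim: "AE x in ?N. (\<lambda>n. ?s n x) \<longlonglongrightarrow> g x"
    proof (rule AE_I2)
      fix x assume "x \<in> space ?N"
      then have "x \<in> {0..t}" by (simp add: space_restrict_space)
      then show "(\<lambda>n. ?s n x) \<longlonglongrightarrow> g x"
        using g by (intro isCont_tendsto_compose[OF _ round_down_dyadic_tendsto])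
          (auto simp: continuous_on_eq_continuous_at)
    qed
    note conv = bounded_convergence_Lp[OF fin q sm C lim]
    from order_tendstoD(2)[OF conv(2) \<epsilon>] obtain n where "(LINT x|?N. \<bar>?s n x - g x\<bar> powr q) < \<epsilon>"
      by (auto simp: eventually_sequentially)
    then show "\<exists>n \<phi>. dyadic_simple t n \<phi> \<and> in_Lp q ?N \<phi> \<and>
        (LINT x|?N. \<bar>\<phi> x - g x\<bar> powr q) \<le> \<epsilon>"
      using dyadic_simple_sample[OF t, of n g] conv(1)[of n] by (meson less_imp_le)
  qed
  have fm: "f \<in> borel_measurable ?N" using f by (simp add: in_Lp_def)
  have "(\<lambda>x. indicator {0..t} x * f x) \<in> borel_measurable lebesgue"
    using f q by (simp add: in_Lp_restrict_iff) (simp add: in_Lp_def)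
  then have "(\<lambda>x. indicator {0..t} x * f x) measurable_on UNIV"
    by (intro lebesgue_measurable_imp_measurable_on_real) auto
  then obtain Z g where Z: "negligible Z" and g: "\<And>n. continuous_on UNIV (g n)"
    and gl: "\<And>x. x \<notin> Z \<Longrightarrow> (\<lambda>n. g n x) \<longlonglongrightarrow> indicator {0..t} x * f x"
    unfolding measurable_on_def by auto
  have "AE x in lebesgue. x \<notin> Z"
    using Z by (auto simp: negligible_iff_null_sets intro: AE_not_in)
  then have AEZ: "AE x in ?N. x \<notin> Z"
    by (subst AE_restrict_space_iff) auto
  have truncated: "approx (\<lambda>x. clamp_abs (real k) (f x))"
      "in_Lp q ?N (\<lambda>x. clamp_abs (real k) (f x))" for k
  proof -
    have cm: "clamp_abs (real k) \<in> borel_measurable borel"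
      using continuous_clamp_abs by (rule borel_measurable_continuous_onI)
    have cg: "continuous_on UNIV (\<lambda>x. clamp_abs (real k) (g n x))" for n
      using continuous_on_compose2[OF continuous_clamp_abs g[of n]] by auto
    have m: "(\<lambda>x. clamp_abs (real k) (g n x)) \<in> borel_measurable ?N" for n
      using borel_measurable_continuous_onI[OF cg]
      by (intro measurable_restrict_space1 measurable_completion) auto
    have m': "(\<lambda>x. clamp_abs (real k) (f x)) \<in> borel_measurable ?N"
      using measurable_compose[OF fm cm] .
    have b: "\<bar>clamp_abs (real k) y\<bar> \<le> real k" for y by (rule abs_clamp_abs_le) simp
    have "AE x in ?N. x \<in> {0..t}" by (rule AE_I2) (simp add: space_restrict_space)
    with AEZ have lim: "AE x in ?N. (\<lambda>n. clamp_abs (real k) (g n x)) \<longlonglongrightarrow> clamp_abs (real k) (f x)"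
    proof eventually_elim
      case (elim x)
      then have "(\<lambda>n. g n x) \<longlonglongrightarrow> f x" using gl[of x] by simp
      then show ?case
        using continuous_clamp_abs[of "real k"]
        by (intro isCont_tendsto_compose[where g = "clamp_abs (real k)"])
          (auto simp: continuous_on_eq_continuous_at)
    qed
    note conv = bounded_convergence_Lp[OF fin q m m' b lim]
    show inL: "in_Lp q ?N (\<lambda>x. clamp_abs (real k) (f x))"
      using bounded_convergence_Lp(1)[OF fin q m' m' b] by simp
    show "approx (\<lambda>x. clamp_abs (real k) (f x))"
      by (rule closed[OF conv(1) continuous[OF cg b] inL conv(2)])
  qed
  have "approx f"
    by (rule closed[OF truncated(2) truncated(1) f truncation_tendsto_Lp[OF q f]])
  then show ?thesis using \<epsilon> by (simp add: approx_def)
qed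

lemma simple_approximation_exists:
  assumes "0 \<le> t" "0 < \<alpha>" "in_Lp (2 / (1 + \<alpha>)) (lebesgue_on {0..t}) f"
  shows "\<exists>m \<phi>. simple_approximation \<alpha> f t m \<phi>"
proof -
  define q where "q = 2 / (1 + \<alpha>)"
  have q: "0 < q" using assms by (simp add: q_def)
  let ?N = "lebesgue_on {0..t}"
  have "\<forall>n. \<exists>m \<phi>. dyadic_simple t m \<phi> \<and> in_Lp q ?N \<phi> \<and>
      (LINT x|?N. \<bar>\<phi> x - f x\<bar> powr q) \<le> inverse (real (Suc n))"
    using assms q by (intro allI dyadic_simple_dense) (auto simp: q_def)
  then obtain m \<phi> where *: "\<And>n. dyadic_simple t (m n) (\<phi> n)" "\<And>n. in_Lp q ?N (\<phi> n)"
    "\<And>n. (LINT x|?N. \<bar>\<phi> n x - f x\<bar> powr q) \<le> inverse (real (Suc n))"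
    by metis
  have "(\<lambda>n. LINT x|?N. \<bar>\<phi> n x - f x\<bar> powr q) \<longlonglongrightarrow> 0"
  proof (rule tendsto_sandwich[OF _ _ tendsto_const LIMSEQ_inverse_real_of_nat])
    show "\<forall>\<^sub>F n in sequentially. (LINT x|?N. \<bar>\<phi> n x - f x\<bar> powr q) \<le> inverse (real (Suc n))"
      by (intro always_eventually allI *(3))
  qed simp
  then have "simple_approximation \<alpha> f t m \<phi>"
    using * assms q by (simp add: simple_approximation_def tendsto_in_Lp_iff q_def)
  then show ?thesis by blast
qed

section \<open>Measurable modifications\<close>

text \<open>A process that is uniformly continuous in \<open>L\<^sup>2\<close> has a jointly measurable modification:
  sampled at sufficiently fine time grids, it takes countably many values in time, hence is
  jointly measurable, and the samples converge almost surely at every fixed time.\<close>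

lemma measurable_modification:
  fixes Y :: "real \<Rightarrow> 'a \<Rightarrow> real"
  assumes Y: "\<And>t. 0 \<le> t \<Longrightarrow> in_Lp 2 M (Y t)"
    and cont: "\<And>\<epsilon>. 0 < \<epsilon> \<Longrightarrow> \<exists>\<delta>>0. \<forall>s t. 0 \<le> s \<and> s \<le> t \<and> t - s < \<delta> \<longrightarrow>
                 (LINT \<omega>|M. (Y s \<omega> - Y t \<omega>)\<^sup>2) \<le> \<epsilon>"
  shows "\<exists>J. (\<lambda>(t, \<omega>). J t \<omega>) \<in> borel_measurable (borel \<Otimes>\<^sub>M M) \<and> (\<forall>t\<ge>0. AE \<omega> in M. J t \<omega> = Y t \<omega>)"
proof -
  have "\<forall>k::nat. \<exists>\<delta>>0. \<forall>s t. 0 \<le> s \<and> s \<le> t \<and> t - s < \<delta> \<longrightarrow> (LINT \<omega>|M. (Y s \<omega> - Y t \<omega>)\<^sup>2) \<le> (1/4) ^ k"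
    by (intro allI cont) simp
  then obtain \<delta> where \<delta>: "\<And>k::nat. 0 < \<delta> k"
    "\<And>k s t. 0 \<le> s \<Longrightarrow> s \<le> t \<Longrightarrow> t - s < \<delta> k \<Longrightarrow> (LINT \<omega>|M. (Y s \<omega> - Y t \<omega>)\<^sup>2) \<le> (1/4) ^ k"
    by metis
  define Z where "Z k t = Y (round_down (\<delta> k) t)" for k t
  have rd0: "0 \<le> round_down (\<delta> k) t" for k t
    using \<delta>(1)[of k] by (simp add: round_down_def)
  define J where "J t \<omega> = lim (\<lambda>k. Z k t \<omega>)" for t \<omega>
  have Zm: "(\<lambda>x. Z k (fst x) (snd x)) \<in> borel_measurable (borel \<Otimes>\<^sub>M M)" for k
    unfolding Z_def round_down_def
  proof (rule measurable_compose_countable[where f = "\<lambda>i x. Y (real i * \<delta> k) (snd x)"])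
    fix i :: nat
    have [measurable]: "Y (real i * \<delta> k) \<in> borel_measurable M"
      using Y[of "real i * \<delta> k"] \<delta>(1)[of k] by (simp add: in_Lp_2_iff)
    show "(\<lambda>x. Y (real i * \<delta> k) (snd x)) \<in> borel_measurable (borel \<Otimes>\<^sub>M M)" by measurable
    show "(\<lambda>x. nat \<lfloor>fst x / \<delta> k\<rfloor>) \<in> borel \<Otimes>\<^sub>M M \<rightarrow>\<^sub>M count_space UNIV" by measurable
  qed
  have "(\<lambda>(t, \<omega>). J t \<omega>) \<in> borel_measurable (borel \<Otimes>\<^sub>M M)"
    unfolding J_def split_beta' using Zm by (rule borel_measurable_lim_metric)
  moreover have "AE \<omega> in M. J t \<omega> = Y t \<omega>" if t: "0 \<le> t" for t
  proof -
    have "AE \<omega> in M. summable (\<lambda>k. \<bar>Z k t \<omega> - Y t \<omega>\<bar>)"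
    proof (rule AE_summable_of_second_moments)
      show "in_Lp 2 M (\<lambda>\<omega>. Z k t \<omega> - Y t \<omega>)" for k
        unfolding Z_def by (intro in_Lp_diff Y rd0 t) simp
      show "(LINT \<omega>|M. (Z k t \<omega> - Y t \<omega>)\<^sup>2) \<le> (1/4) ^ k" for k
        unfolding Z_def using round_down_bounds[OF \<delta>(1)[of k] t] by (intro \<delta>(2)) auto
    qed
    then show ?thesis
    proof eventually_elim
      case (elim \<omega>)
      then have "(\<lambda>k. \<bar>Z k t \<omega> - Y t \<omega>\<bar>) \<longlonglongrightarrow> 0" by (rule summable_LIMSEQ_zero)
      then have "(\<lambda>k. Z k t \<omega>) \<longlonglongrightarrow> Y t \<omega>"
        by (simp add: tendsto_rabs_zero_iff LIM_zero_iff)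
      then show ?case by (simp add: J_def limI)
    qed
  qed
  ultimately show ?thesis by blast
qed

text \<open>Absolute continuity of the integral: the part of \<open>h\<close> above a high level is small in mean,
  the part below contributes at most the level times the length of the interval.\<close>

lemma integral_short_interval_small:
  fixes h :: "real \<Rightarrow> real"
  assumes h: "integrable lebesgue h" and h0: "\<And>x. 0 \<le> h x" and \<epsilon>: "0 < \<epsilon>"
  shows "\<exists>\<delta>>0. \<forall>s t. s \<le> t \<and> t - s < \<delta> \<longrightarrow> (LINT x|lebesgue. indicator {s..t} x * h x) \<le> \<epsilon>"
proof -
  have [measurable]: "h \<in> borel_measurable lebesgue" using h by simp
  let ?r = "\<lambda>k x. h x - min (h x) (real k)"
  have rint: "integrable lebesgue (?r k)" for k
    by (rule Bochner_Integration.integrable_bound[OF h]) (use h0 in auto)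
  have "(\<lambda>k. LINT x|lebesgue. ?r k x) \<longlonglongrightarrow> (LINT x|(lebesgue::real measure). 0::real)"
  proof (rule integral_dominated_convergence[OF _ _ h])
    show "AE x in lebesgue. (\<lambda>k. ?r k x) \<longlonglongrightarrow> 0"
    proof (rule AE_I2)
      fix x
      obtain k0 :: nat where "h x \<le> real k0" using real_arch_simple by blast
      then have "?r k x = 0" if "k0 \<le> k" for k using that by (simp add: min_def)
      then show "(\<lambda>k. ?r k x) \<longlonglongrightarrow> 0"
        by (intro tendsto_eventually) (auto simp: eventually_sequentially)
    qed
  qed (use h0 in auto)
  then have "(\<lambda>k. LINT x|lebesgue. ?r k x) \<longlonglongrightarrow> 0" by simp
  from order_tendstoD(2)[OF this, of "\<epsilon> / 2"] \<epsilon> obtain k where k: "(LINT x|lebesgue. ?r k x) < \<epsilon> / 2"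
    by (auto simp: eventually_sequentially)
  define \<delta> where "\<delta> = \<epsilon> / (2 * (real k + 1))"
  have "(LINT x|lebesgue. indicator {s..t} x * h x) \<le> \<epsilon>" if st: "s \<le> t" "t - s < \<delta>" for s t
  proof -
    have ii: "integrable lebesgue (\<lambda>x. real k * indicator {s..t} x)"
      by (intro integrable_mult_right integrable_real_indicator) (auto simp: emeasure_lborel_Icc_eq)
    have "(LINT x|lebesgue. indicator {s..t} x * h x) \<le> (LINT x|lebesgue. ?r k x + real k * indicator {s..t} x)"
    proof (rule integral_mono)
      show "integrable lebesgue (\<lambda>x. indicator {s..t} x * h x)"
        using integrable_mult_indicator[of "{s..t}" lebesgue h] h by simp
      show "integrable lebesgue (\<lambda>x. ?r k x + real k * indicator {s..t} x)"
        using rint ii by (rule Bochner_Integration.integrable_add)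
      show "indicator {s..t} x * h x \<le> ?r k x + real k * indicator {s..t} x" for x
        using h0[of x] by (auto simp: indicator_def)
    qed
    also have "\<dots> = (LINT x|lebesgue. ?r k x) + (LINT x|lebesgue. real k * indicator {s..t} x)"
      using rint ii by (rule Bochner_Integration.integral_add)
    also have "(LINT x|lebesgue. real k * indicator {s..t} x) = real k * (t - s)"
      using st by simp
    also have "real k * (t - s) \<le> (real k + 1) * \<delta>"
      using st by (intro mult_mono) auto
    also have "\<dots> = \<epsilon> / 2" by (simp add: \<delta>_def field_simps)
    finally show ?thesis using k by simp
  qed
  moreover have "0 < \<delta>" using \<epsilon> by (simp add: \<delta>_def)
  ultimately show ?thesis by blast
qed

section \<open>The stochastic integral as a process\<close>

context fbm
begin

text \<open>A dyadic simple function agrees on \<open>[0, t)\<close> with the step function over its cells. The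
  single point \<open>t\<close>, where they may differ, does not change integrals.\<close>

lemma simple_approximation_elementary:
  assumes t: "0 \<le> t" and appr: "simple_approximation \<alpha> f t m \<phi>"
  shows "\<exists>g. elementary_approximation (\<lambda>x. indicator {0..t} x * f x) g
           (\<lambda>n. simple_stochastic_integral \<xi> t (m n) (\<phi> n))"
proof -
  let ?d = "\<lambda>n. dyadic_point t (m n)"
  define g where "g n x = (\<Sum>i<2 ^ m n. \<phi> n (?d n i) * indicator {?d n i..<?d n (Suc i)} x)" for n x
  have simple: "dyadic_simple t (m n) (\<phi> n)" for n
    using appr by (simp add: simple_approximation_def)
  have L: "in_Lp p (lebesgue_on {0..t}) (\<phi> n)" "in_Lp p (lebesgue_on {0..t}) f"
    and lim: "(\<lambda>n. LINT x|lebesgue_on {0..t}. \<bar>\<phi> n x - f x\<bar> powr p) \<longlonglongrightarrow> 0" for n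
    using appr p_pos by (auto simp: simple_approximation_def tendsto_in_Lp_iff p_def[symmetric])
  have mono: "0 \<le> ?d n i \<and> ?d n i \<le> ?d n (Suc i)" for n i
    using t unfolding dyadic_point_eq by (intro conjI mult_right_mono mult_nonneg_nonneg) auto
  have el: "elementary_integral \<xi> (g n) (simple_stochastic_integral \<xi> t (m n) (\<phi> n))" for n
    using elementary_integralI[of "2 ^ m n" "?d n" "\<lambda>i. ?d n (Suc i)" \<xi> "\<lambda>i. \<phi> n (?d n i)"] mono
    by (simp add: g_def[abs_def] simple_stochastic_integral_def[abs_def])
  have g_eq: "g n x = indicator {0..<t} x * \<phi> n x" for n x
  proof (cases "x \<in> {0..<t}")
    case True
    then show ?thesis using simple[of n] by (simp add: dyadic_simple_def g_def)
  next
    case False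
    have "?d n (Suc i) \<le> t" if "i < 2 ^ m n" for i
    proof -
      have "real (Suc i) \<le> real (2 ^ m n)" using that by (intro of_nat_mono) simp
      then have "real (Suc i) * (t / 2 ^ m n) \<le> real (2 ^ m n) * (t / 2 ^ m n)"
        using t by (intro mult_right_mono) auto
      then show ?thesis by (simp add: dyadic_point_eq)
    qed
    then have "indicator {?d n i..<?d n (Suc i)} x = (0::real)" if "i < 2 ^ m n" for i
      using that False mono[of n i] by (fastforce simp: indicator_def)
    then show ?thesis using False by (simp add: g_def)
  qed
  have "Lp_dist (g n) (\<lambda>x. indicator {0..t} x * f x) =
      (LINT x|lebesgue_on {0..t}. \<bar>\<phi> n x - f x\<bar> powr p)" for n
  proof -
    have "Lp_dist (g n) (\<lambda>x. indicator {0..t} x * f x) =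
        (LINT x|lebesgue. \<bar>indicator {0..t} x * (\<phi> n x - f x)\<bar> powr p)"
    proof (rule integral_cong_AE)
      have "in_Lp p (lebesgue_on {0..t}) (\<lambda>x. \<phi> n x - f x)"
        using L p_pos by (intro in_Lp_diff)
      then show "(\<lambda>x. \<bar>indicator {0..t} x * (\<phi> n x - f x)\<bar> powr p) \<in> borel_measurable lebesgue"
        using p_pos by (intro borel_measurable_integrable) (simp add: in_Lp_restrict_iff in_Lp_def[of p lebesgue])
      have "in_Lp p lebesgue (\<lambda>x. g n x - indicator {0..t} x * f x)"
        using L(2) p_pos elementary_integral_in_Lp[OF el p_pos]
        by (intro in_Lp_diff) (auto simp: in_Lp_restrict_iff)
      then show "(\<lambda>x. \<bar>g n x - indicator {0..t} x * f x\<bar> powr p) \<in> borel_measurable lebesgue"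
        by (intro borel_measurable_integrable) (simp add: in_Lp_def[of p lebesgue])
      have "AE x in lebesgue. x \<noteq> t"
        using AE_not_in[of "{t}" "lebesgue"] by (auto simp: negligible_iff_null_sets[symmetric])
      then show "AE x in lebesgue. \<bar>g n x - indicator {0..t} x * f x\<bar> powr p =
          \<bar>indicator {0..t} x * (\<phi> n x - f x)\<bar> powr p"
        by eventually_elim (auto simp: g_eq indicator_def)
    qed
    then show ?thesis using p_pos by (simp add: integral_abs_powr_restrict)
  qed
  then have "elementary_approximation (\<lambda>x. indicator {0..t} x * f x) g
      (\<lambda>n. simple_stochastic_integral \<xi> t (m n) (\<phi> n))"
    using el lim by (simp add: elementary_approximation_def)
  then show ?thesis by blast
qed

lemma has_stochastic_integral_wiener:
  assumes t: "0 \<le> t" and ex: "\<exists>m \<phi>. simple_approximation \<alpha> f t m \<phi>"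
    and Y: "wiener_integral (\<lambda>x. indicator {0..t} x * f x) Y"
  shows "has_stochastic_integral M \<alpha> \<xi> f t Y"
  unfolding has_stochastic_integral_def
proof (intro conjI allI impI ex)
  fix m \<phi> assume "simple_approximation \<alpha> f t m \<phi>"
  then obtain g where g: "elementary_approximation (\<lambda>x. indicator {0..t} x * f x) g
      (\<lambda>n. simple_stochastic_integral \<xi> t (m n) (\<phi> n))"
    using simple_approximation_elementary[OF t] by blast
  have "in_Lp 2 M (simple_stochastic_integral \<xi> t (m n) (\<phi> n))" for n
    using g elementary_in_L2 unfolding elementary_approximation_def by blast
  moreover have "in_Lp 2 M Y" using Y by (simp add: wiener_integral_def)
  ultimately show "tendsto_in_Lp 2 M (\<lambda>n. simple_stochastic_integral \<xi> t (m n) (\<phi> n)) Y"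
    using wiener_integral_limit[OF Y g] by (simp add: tendsto_in_Lp_iff abs_powr_2)
qed

lemma wiener_integral_cong_AE:
  assumes Y: "wiener_integral G Y" and eq: "AE \<omega> in M. Z \<omega> = Y \<omega>" and Z: "Z \<in> borel_measurable M"
  shows "wiener_integral G Z"
proof -
  have [measurable]: "Z \<in> borel_measurable M" "Y \<in> borel_measurable M"
    using Z Y by (auto simp: wiener_integral_def in_Lp_2_iff)
  have "integrable M (\<lambda>\<omega>. (Z \<omega>)\<^sup>2) \<longleftrightarrow> integrable M (\<lambda>\<omega>. (Y \<omega>)\<^sup>2)"
    using eq by (intro integrable_cong_AE) auto
  moreover have "expectation (\<lambda>\<omega>. (X \<omega> - Z \<omega>)\<^sup>2) = expectation (\<lambda>\<omega>. (X \<omega> - Y \<omega>)\<^sup>2)"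
    if [measurable]: "X \<in> borel_measurable M" for X
    using eq by (intro integral_cong_AE) auto
  ultimately show ?thesis
    using Y Z by (simp add: wiener_integral_def in_Lp_2_iff elementary_integral_square_integrable(1))
qed

lemma in_Lp_truncate:
  fixes f :: "real \<Rightarrow> real"
  assumes "in_Lp p (lebesgue_on {0..}) f"
  shows "in_Lp p (lebesgue_on {0..t}) f"
proof -
  have F: "in_Lp p lebesgue (\<lambda>x. indicator {0..} x * f x)"
    using assms p_pos by (subst in_Lp_restrict_iff[symmetric]) auto
  have eq: "(\<lambda>x. indicator {0..t} x * f x) = (\<lambda>x. indicator {0..t} x * (indicator {0..} x * f x))"
    by (auto simp: indicator_def)
  have "in_Lp p lebesgue (\<lambda>x. indicator {0..t} x * (indicator {0..} x * f x))"
    unfolding in_Lp_def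
  proof
    have mF: "(\<lambda>x. indicator {0..} x * f x) \<in> borel_measurable lebesgue"
      using F by (simp add: in_Lp_def)
    show m: "(\<lambda>x. indicator {0..t} x * (indicator {0..} x * f x)) \<in> borel_measurable lebesgue"
      by (intro borel_measurable_times borel_measurable_indicator mF) auto
    show "integrable lebesgue (\<lambda>x. \<bar>indicator {0..t} x * (indicator {0..} x * f x)\<bar> powr p)"
    proof (rule Bochner_Integration.integrable_bound)
      show "integrable lebesgue (\<lambda>x. \<bar>indicator {0..} x * f x\<bar> powr p)"
        using F by (simp add: in_Lp_def)
    qed (use m p_pos in \<open>auto simp: indicator_def\<close>)
  qed
  then show ?thesis using p_pos by (simp add: in_Lp_restrict_iff eq)
qed

text \<open>The dyadic grids of \<open>[0, s]\<close> and \<open>[0, t]\<close> in general have no common equidistant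
  refinement. The distance of the two integrals is nevertheless controlled by the integral of
  \<open>\<bar>f\<bar> powr p\<close> over \<open>[s, t]\<close>, because both are compared with elementary integrals on arbitrary
  partitions. This gives uniform mean-square continuity in time, hence a jointly measurable
  version, to which Tonelli's theorem applies.\<close>

theorem stochastic_integral_exists:
  assumes f: "in_Lp p (lebesgue_on {0..}) f"
  shows "\<exists>I. (\<forall>t\<ge>0. has_stochastic_integral M \<alpha> \<xi> f t (I t)) \<and>
    (\<forall>T\<ge>0. in_Lp 2 (lebesgue_on {0..T} \<Otimes>\<^sub>M M) (\<lambda>(t, \<omega>). I t \<omega>))"
proof -
  define G where "G t x = indicator {0..t} x * f x" for t x
  define F where "F x = indicator {0..} x * f x" for x
  have ft: "in_Lp p (lebesgue_on {0..t}) f" for t using f by (rule in_Lp_truncate)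
  have GL: "in_Lp p lebesgue (G t)" for t
    using ft p_pos by (simp add: G_def[abs_def] in_Lp_restrict_iff)
  have FL: "in_Lp p lebesgue F"
    using f p_pos unfolding F_def[abs_def] by (subst in_Lp_restrict_iff[symmetric]) auto
  then have Fint: "integrable lebesgue (\<lambda>x. \<bar>F x\<bar> powr p)" by (simp add: in_Lp_def)
  have ex: "\<exists>m \<phi>. simple_approximation \<alpha> f t m \<phi>" if "0 \<le> t" for t
    using that \<alpha>_pos ft by (intro simple_approximation_exists) (auto simp: p_def)
  have el: "\<exists>g X. elementary_approximation (G t) g X" if "0 \<le> t" for t
    using ex[OF that] simple_approximation_elementary[OF that, of f] unfolding G_def[abs_def] by blast
  have "\<exists>Y. wiener_integral (G t) Y" if "0 \<le> t" for t
    using el[OF that] wiener_integral_exists[OF GL] by blast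
  then obtain Y where Y: "\<And>t. 0 \<le> t \<Longrightarrow> wiener_integral (G t) (Y t)" by metis
  have YL: "in_Lp 2 M (Y t)" if "0 \<le> t" for t
    using Y[OF that] by (simp add: wiener_integral_def)
  have Ydist: "expectation (\<lambda>\<omega>. (Y s \<omega> - Y t \<omega>)\<^sup>2)
      \<le> 64 * K * (LINT x|lebesgue. indicator {s..t} x * \<bar>F x\<bar> powr p) powr (1 + \<alpha>)"
    if st: "0 \<le> s" "s \<le> t" for s t
  proof -
    from el[OF st(1)] obtain g X where gX: "elementary_approximation (G s) g X" by blast
    have t0: "0 \<le> t" using st by simp
    have "Lp_dist (G s) (G t) \<le> (LINT x|lebesgue. indicator {s..t} x * \<bar>F x\<bar> powr p)"
    proof (rule integral_mono)
      show "integrable lebesgue (\<lambda>x. \<bar>G s x - G t x\<bar> powr p)"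
        using in_Lp_diff[OF p_pos GL GL] by (simp add: in_Lp_def)
      show "integrable lebesgue (\<lambda>x. indicator {s..t} x * \<bar>F x\<bar> powr p)"
        using integrable_mult_indicator[OF _ Fint, of "{s..t}"] by simp
      show "\<bar>G s x - G t x\<bar> powr p \<le> indicator {s..t} x * \<bar>F x\<bar> powr p" for x
        using st p_pos by (auto simp: G_def F_def indicator_def)
    qed
    then have "64 * K * Lp_dist (G s) (G t) powr (1 + \<alpha>)
        \<le> 64 * K * (LINT x|lebesgue. indicator {s..t} x * \<bar>F x\<bar> powr p) powr (1 + \<alpha>)"
      using K_nonneg \<alpha>_pos by (intro mult_left_mono powr_mono2) auto
    moreover have "expectation (\<lambda>\<omega>. (Y s \<omega> - Y t \<omega>)\<^sup>2) \<le> 64 * K * Lp_dist (G s) (G t) powr (1 + \<alpha>)"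
      by (rule wiener_integral_dist[OF Y[OF st(1)] Y[OF t0] GL GL gX])
    ultimately show ?thesis by linarith
  qed
  have "\<exists>J. (\<lambda>(t, \<omega>). J t \<omega>) \<in> borel_measurable (borel \<Otimes>\<^sub>M M) \<and> (\<forall>t\<ge>0. AE \<omega> in M. J t \<omega> = Y t \<omega>)"
  proof (rule measurable_modification[OF YL])
    fix \<epsilon> :: real assume "0 < \<epsilon>"
    then obtain \<eta> where \<eta>: "0 < \<eta>" "\<And>x. 0 \<le> x \<Longrightarrow> x \<le> \<eta> \<Longrightarrow> (64 * K) * x powr (1 + \<alpha>) \<le> \<epsilon>"
      using mult_powr_small[of "64 * K" "1 + \<alpha>" \<epsilon>] K_nonneg \<alpha>_pos by auto
    from integral_short_interval_small[OF Fint _ \<eta>(1)] obtain \<delta> where \<delta>: "0 < \<delta>"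
      "\<And>s t. s \<le> t \<Longrightarrow> t - s < \<delta> \<Longrightarrow> (LINT x|lebesgue. indicator {s..t} x * \<bar>F x\<bar> powr p) \<le> \<eta>"
      by auto
    have "expectation (\<lambda>\<omega>. (Y s \<omega> - Y t \<omega>)\<^sup>2) \<le> \<epsilon>" if "0 \<le> s" "s \<le> t" "t - s < \<delta>" for s t
      using Ydist[OF that(1,2)] \<eta>(2)[OF _ \<delta>(2)[OF that(2,3)]] by simp
    with \<delta>(1) show "\<exists>\<delta>>0. \<forall>s t. 0 \<le> s \<and> s \<le> t \<and> t - s < \<delta> \<longrightarrow> expectation (\<lambda>\<omega>. (Y s \<omega> - Y t \<omega>)\<^sup>2) \<le> \<epsilon>"
      by blast
  qed
  then obtain J where Jm: "(\<lambda>(t, \<omega>). J t \<omega>) \<in> borel_measurable (borel \<Otimes>\<^sub>M M)"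
    and J: "\<And>t. 0 \<le> t \<Longrightarrow> AE \<omega> in M. J t \<omega> = Y t \<omega>" by blast
  have Jt: "J t \<in> borel_measurable M" for t
    using measurable_compose[OF measurable_Pair1'[of t borel M] Jm] by simp
  have wJ: "wiener_integral (G t) (J t)" if "0 \<le> t" for t
    using wiener_integral_cong_AE[OF Y[OF that] J[OF that] Jt] .
  define B where "B = 8 * K * (LINT x|lebesgue. \<bar>F x\<bar> powr p) powr (1 + \<alpha>)"
  have JB: "(\<integral>\<^sup>+\<omega>. ennreal ((J t \<omega>)\<^sup>2) \<partial>M) \<le> ennreal B" if "0 \<le> t" for t
  proof -
    have "(\<integral>\<^sup>+\<omega>. ennreal ((J t \<omega>)\<^sup>2) \<partial>M) = ennreal (expectation (\<lambda>\<omega>. (J t \<omega>)\<^sup>2))"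
      using wJ[OF that] by (intro nn_integral_eq_integral) (auto simp: wiener_integral_def in_Lp_2_iff)
    also have "ennreal (expectation (\<lambda>\<omega>. (J t \<omega>)\<^sup>2)) \<le> ennreal B"
    proof (rule ennreal_leI)
      have "(LINT x|lebesgue. \<bar>G t x\<bar> powr p) \<le> (LINT x|lebesgue. \<bar>F x\<bar> powr p)"
        using GL[of t] FL p_pos
        by (intro integral_mono) (auto simp: in_Lp_def G_def F_def indicator_def)
      then have "8 * K * (LINT x|lebesgue. \<bar>G t x\<bar> powr p) powr (1 + \<alpha>) \<le> B"
        unfolding B_def using K_nonneg \<alpha>_pos by (intro mult_left_mono powr_mono2) auto
      with wiener_integral_second_moment[OF wJ[OF that]]
      show "expectation (\<lambda>\<omega>. (J t \<omega>)\<^sup>2) \<le> B" by linarith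
    qed
    finally show ?thesis .
  qed
  have "in_Lp 2 (lebesgue_on {0..T} \<Otimes>\<^sub>M M) (\<lambda>(t, \<omega>). J t \<omega>)" if "0 \<le> T" for T
  proof -
    let ?N = "lebesgue_on {0..T}"
    have "(\<lambda>x. x) \<in> borel_measurable ?N"
      by (intro measurable_restrict_space1 measurable_completion) simp
    then have "(\<lambda>x. (fst x, snd x)) \<in> ?N \<Otimes>\<^sub>M M \<rightarrow>\<^sub>M borel \<Otimes>\<^sub>M M"
      by (intro measurable_Pair measurable_compose[OF measurable_fst] measurable_snd)
    from measurable_compose[OF this Jm]
    have meas[measurable]: "(\<lambda>(t, \<omega>). J t \<omega>) \<in> borel_measurable (?N \<Otimes>\<^sub>M M)" by (simp add: split_beta')
    have "(\<integral>\<^sup>+x. ennreal ((case x of (t, \<omega>) \<Rightarrow> J t \<omega>)\<^sup>2) \<partial>(?N \<Otimes>\<^sub>M M)) =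
        (\<integral>\<^sup>+t. \<integral>\<^sup>+\<omega>. ennreal ((J t \<omega>)\<^sup>2) \<partial>M \<partial>?N)"
      by (subst nn_integral_fst[symmetric]) auto
    also have "\<dots> \<le> (\<integral>\<^sup>+t. ennreal B \<partial>?N)"
      using JB by (intro nn_integral_mono) (auto simp: space_restrict_space)
    also have "\<dots> = ennreal B * emeasure ?N (space ?N)" by simp
    also have "\<dots> < \<infinity>"
      by (auto simp: space_restrict_space emeasure_restrict_space emeasure_lborel_Icc_eq ennreal_mult_less_top)
    finally show ?thesis
      unfolding in_Lp_2_iff using meas by (auto intro!: integrableI_bounded)
  qed
  moreover have "has_stochastic_integral M \<alpha> \<xi> f t (J t)" if "0 \<le> t" for t
    using has_stochastic_integral_wiener[OF that ex[OF that]] wJ[OF that]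
    by (simp add: G_def[abs_def])
  ultimately show ?thesis by blast
qed

end

theorem mainTheorem5:
  fixes M :: "'a measure" and \<alpha> :: real and \<xi> :: "real \<Rightarrow> 'a \<Rightarrow> real" and f :: "real \<Rightarrow> real"
  assumes "0 < \<alpha>" and "\<alpha> < 1"
    and "prob_space M"
    and "fractional_brownian_motion M \<alpha> \<xi>"
    and "in_Lp (2 / (1 + \<alpha>)) (lebesgue_on {0..}) f"
  shows "\<exists>I :: real \<Rightarrow> 'a \<Rightarrow> real.
           (\<forall>t\<ge>0. has_stochastic_integral M \<alpha> \<xi> f t (I t)) \<and>
           (\<forall>T\<ge>0. in_Lp 2 (lebesgue_on {0..T} \<Otimes>\<^sub>M M) (\<lambda>(t, \<omega>). I t \<omega>))"
proof -
  interpret fbm M \<alpha> \<xi>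
    using assms by (simp add: fbm_def fbm_axioms_def)
  show ?thesis
    using assms(5) by (intro stochastic_integral_exists) (simp add: p_def)
qed

end
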